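(* Let $\mathcal T$ be an unweighted tree on $n\ge5$ nodes and let $\beta>0$. Then $$\frac1{2\beta}+\frac{(n-2)^3}{2\beta(2n-3)^2}\ <\ \rho_{ss}(A^{(2)}_{\mathcal T};M_n\oplus 0)\ <\ \frac{(n^2-1)^2}{72\beta}-\frac{(n-1)(n-2)^2}{2n\beta}.$$
   Context: Graphs are finite, simple, undirected. For a connected graph $\mathcal G$ on $n$ nodes, $L_{\mathcal G}$ is the graph Laplacian (degree matrix minus adjacency matrix) with eigenvalues $0=\lambda_1<\lambda_2\le\dots\le\lambda_n$, $M_n=I_n-\frac1nJ_n$ is the centering matrix, and $\rho_{ss}(A^{(2)}_{\mathcal G};M_n\oplus 0)=\frac1{2\beta}\sum_{i=2}^n\lambda_i^{-2}$ is the performance measure of the Type 2 second-order consensus network $\dot x=v$, $\dot v=-L_{\mathcal G}x-\beta L_{\mathcal G}v+\xi$ with output $M_nx$. *)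

theory Defs
  imports "Jordan_Normal_Form.Char_Poly" "HOL-Library.Multiset"
begin

(* A graph on n nodes has node set {0..<n} and a set E of two-element edges. *)

definition simple_graph :: "nat \<Rightarrow> nat set set \<Rightarrow> bool" where
  "simple_graph n E \<longleftrightarrow> (\<forall>e\<in>E. e \<subseteq> {0..<n} \<and> card e = 2)"

definition graph_connected :: "nat \<Rightarrow> nat set set \<Rightarrow> bool" where
  "graph_connected n E \<longleftrightarrow>
     n > 0 \<and> (\<forall>u<n. \<forall>v<n. (u, v) \<in> {(x, y). {x, y} \<in> E}\<^sup>*)"

(* Cycles have at least three nodes. The notion of tree of Graph_Theory is not usable here: in a
   symmetric digraph, traversing an edge forth and back counts there as a cycle. *)
definition graph_cycle :: "nat set set \<Rightarrow> nat list \<Rightarrow> bool" where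
  "graph_cycle E p \<longleftrightarrow> length p \<ge> 3 \<and> distinct p \<and>
     (\<forall>i<length p. {p ! i, p ! ((i + 1) mod length p)} \<in> E)"

definition is_tree :: "nat \<Rightarrow> nat set set \<Rightarrow> bool" where
  "is_tree n E \<longleftrightarrow> simple_graph n E \<and> graph_connected n E \<and> \<not> (\<exists>p. graph_cycle E p)"

definition adjacency_matrix :: "nat \<Rightarrow> nat set set \<Rightarrow> real mat" where
  "adjacency_matrix n E = mat n n (\<lambda>(i, j). if {i, j} \<in> E then 1 else 0)"

definition degree_matrix :: "nat \<Rightarrow> nat set set \<Rightarrow> real mat" where
  "degree_matrix n E = mat n n (\<lambda>(i, j). if i = j then real (card {e \<in> E. i \<in> e}) else 0)"

definition laplacian :: "nat \<Rightarrow> nat set set \<Rightarrow> real mat" where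
  "laplacian n E = degree_matrix n E - adjacency_matrix n E"

(* The eigenvalues \<lambda>_1 \<le> ... \<le> \<lambda>_n with multiplicity; the list index starts at 0, i at 1.
   The Laplacian is real symmetric, so its characteristic polynomial has n real roots. *)
definition laplacian_eigenvalue :: "nat \<Rightarrow> nat set set \<Rightarrow> nat \<Rightarrow> real" where
  "laplacian_eigenvalue n E i =
     sorted_list_of_multiset (proots (char_poly (laplacian n E))) ! (i - 1)"

(* The performance measure rho_ss(A^(2); M_n \<oplus> 0) of the Type 2 second-order consensus network
     x' = v,  v' = - L x - \<beta> L v + \<xi>,  y = M_n x,
   of a connected graph, given by its spectral formula. *)
definition rho_ss_type2 :: "real \<Rightarrow> nat \<Rightarrow> nat set set \<Rightarrow> real" where
  "rho_ss_type2 \<beta> n E = 1 / (2 * \<beta>) * (\<Sum>i = 2..n. 1 / (laplacian_eigenvalue n E i)\<^sup>2)"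

end

theory Submission
  imports Defs "Jordan_Normal_Form.Schur_Decomposition"
begin

text \<open>
  Up to the factor \<open>1 / (2 * \<beta>)\<close> the performance measure is the sum of the inverse squares of
  the nonzero Laplacian eigenvalues. For a tree this sum is an explicit function of the sizes of
  the pieces into which the tree falls when edges are removed, and both bounds are inequalities
  about these sizes.

  Root the tree, so that every vertex \<open>v\<close> other than the root stands for the edge to its parent,
  and let \<open>S v\<close> be the set of its descendants. With the incidence matrix \<open>B\<close> the Laplacian is
  \<open>L = B B\<^sup>T\<close>, so its nonzero eigenvalues are those of the invertible edge matrix
  \<open>K = B\<^sup>T B\<close>. The rows \<open>1\<^bsub>S v\<^esub> - |S v| / n\<close> form a left inverse \<open>R\<close> of \<open>B\<close>, and
  the inverse of \<open>K\<close> is their Gram matrix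
  \<open>N v w = |S v \<inter> S w| - |S v| |S w| / n\<close>. Hence the wanted sum is the trace of \<open>N * N\<close>, which is the
  sum of the squares of all entries of \<open>N\<close> (lemma \<open>tree_spectral_sum\<close>).

  A diagonal entry is \<open>s (n - s) / n\<close> with \<open>s = |S v|\<close>, hence at least \<open>(n - 1) / n\<close>. The diagonal
  alone therefore contributes at least \<open>(n - 1)\<^sup>3 / n\<^sup>2\<close>, which already exceeds the
  required lower bound.

  For the upper bound, removing two edges \<open>v\<close> and \<open>w\<close> leaves three components, of sizes
  \<open>a\<close>, \<open>b\<close>, \<open>c\<close>, and the principal minor \<open>N v v * N w w - (N v w)\<^sup>2\<close> equals \<open>a b c / n\<close>, which is at
  least \<open>(n - 2) / n\<close> because \<open>a + b + c = n\<close> (lemmas \<open>cut_gram_minor\<close> and \<open>cut_gram_minor_ge\<close>). So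
  the sum of the squared entries is at most the squared trace of \<open>N\<close> minus
  \<open>(n - 1) (n - 2)\<^sup>2 / n\<close>. The trace is the Wiener index (the sum of all pairwise distances) divided by
  \<open>n\<close>, hence largest for the path, where it is \<open>(n\<^sup>2 - 1) / 6\<close> (lemma \<open>sum_cut_sizes_le\<close>). For
  \<open>n \<ge> 5\<close> the trace estimate is sharp only for paths and the minor estimate only for stars, so
  they cannot both be equalities.
\<close>

section \<open>Rooted trees and their descendant sets\<close>

text \<open>
  The parent function \<open>p\<close> and the descendant sets \<open>S\<close> are built along with the vertex set, one
  leaf \<open>w\<close> with parent \<open>u\<close> at a time: the subtrees that gain \<open>w\<close> are exactly those that contain \<open>u\<close>.
  This makes every property of \<open>S\<close> provable by rule induction. The vertices \<open>v \<in> U - {r}\<close> stand for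
  the edges \<open>{v, p v}\<close>.
\<close>
inductive rooted_tree :: "'a \<Rightarrow> 'a set \<Rightarrow> ('a \<Rightarrow> 'a) \<Rightarrow> ('a \<Rightarrow> 'a set) \<Rightarrow> bool" for r where
  root: "rooted_tree r {r} p (\<lambda>_. {})"
| leaf: "rooted_tree r U p S \<Longrightarrow> u \<in> U \<Longrightarrow> w \<notin> U \<Longrightarrow>
    rooted_tree r (insert w U) (p(w := u))
      (\<lambda>v. if v = w then {w} else if u \<in> S v then insert w (S v) else S v)"

lemma rooted_tree_basic:
  assumes "rooted_tree r U p S"
  shows "finite U" "r \<in> U"
  using assms by (induction rule: rooted_tree.induct) auto

lemma real_card_edges:
  assumes "rooted_tree r U p S"
  shows "real (card (U - {r})) = real (card U) - 1"
proof -
  have "Suc (card (U - {r})) = card U"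
    using rooted_tree_basic[OF assms] by (intro card_Suc_Diff1) auto
  then show ?thesis by linarith
qed

lemma subtree_bounds:
  assumes "rooted_tree r U p S" "v \<in> U - {r}"
  shows "p v \<in> U" "p v \<noteq> v" "v \<in> S v" "p v \<notin> S v" "S v \<subseteq> U - {r}"
  using assms
proof (induction rule: rooted_tree.induct)
  case (leaf U p S u w)
  have r: "r \<in> U" using rooted_tree_basic leaf.hyps by metis
  { case 1 then show ?case using leaf by auto }
  { case 2 then show ?case using leaf by auto }
  { case 3 then show ?case using leaf by auto }
  { case 4 then show ?case using leaf by auto }
  { case 5 show ?case
    proof (cases "v = w")
      case True then show ?thesis using leaf r by auto
    next
      case False
      then have "S v \<subseteq> U - {r}" using leaf.IH(5) 5 by auto
      then show ?thesis using False leaf.hyps r by auto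
    qed }
qed auto

text \<open>
  Walking along an edge changes membership in \<open>S v\<close> only if it is the edge of \<open>v\<close> itself.
\<close>
lemma subtree_mem_iff_parent:
  assumes "rooted_tree r U p S" "v \<in> U - {r}" "x \<in> U - {r}"
  shows "x \<in> S v \<longleftrightarrow> x = v \<or> p x \<in> S v"
  using assms
proof (induction rule: rooted_tree.induct)
  case (leaf U p S u w)
  have r: "r \<in> U" using rooted_tree_basic leaf.hyps by metis
  have sub: "S a \<subseteq> U - {r}" "a \<in> S a" "p a \<in> U" if "a \<in> U - {r}" for a
    using subtree_bounds[OF leaf.hyps(1) that] by auto
  show ?case
  proof (cases "v = w")
    case True then show ?thesis using leaf r sub by auto
  next
    case False
    then have v: "v \<in> U - {r}" using leaf.prems by auto
    then show ?thesis using leaf r sub[OF v] sub(3)[of x] False by (cases "x = w") auto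
  qed
qed auto

lemma subtrees_laminar:
  assumes "rooted_tree r U p S" "v \<in> U - {r}" "w \<in> U - {r}" "v \<noteq> w"
  shows "S v \<inter> S w = {} \<or> S v \<subset> S w \<or> S w \<subset> S v"
  using assms
proof (induction arbitrary: v w rule: rooted_tree.induct)
  case (leaf U p S u z)
  have sub: "S a \<subseteq> U - {r}" if "a \<in> U - {r}" for a
    using subtree_bounds[OF leaf.hyps(1) that] by auto
  consider "v = z" "w \<in> U - {r}" | "w = z" "v \<in> U - {r}" | "v \<in> U - {r}" "w \<in> U - {r}"
    using leaf.prems by blast
  then show ?case
  proof cases
    case 1
    then show ?thesis using sub[OF 1(2)] leaf.hyps by auto
  next
    case 2
    then show ?thesis using sub[OF 2(2)] leaf.hyps by auto
  next
    case 3
    then have "v \<noteq> z" "w \<noteq> z" "z \<notin> S v" "z \<notin> S w" using leaf.hyps sub by auto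
    then show ?thesis using leaf.IH[OF 3 leaf.prems(3)] by auto
  qed
qed auto

lemma arcs_injective:
  assumes "rooted_tree r U p S"
  shows "inj_on (\<lambda>v. {v, p v}) (U - {r})"
  using assms
proof (induction rule: rooted_tree.induct)
  case (leaf U p S u w)
  have "{v, p v} \<subseteq> U" if "v \<in> U - {r}" for v
    using subtree_bounds[OF leaf.hyps(1) that] that by auto
  then show ?case using leaf by (auto simp: inj_on_def doubleton_eq_iff)
qed auto

section \<open>Rooting an acyclic connected graph\<close>

text \<open>
  A simple path along tree edges in either direction; \<open>V\<close> holds the lower ends of the usable edges.
\<close>
definition arc_path :: "('a \<Rightarrow> 'a) \<Rightarrow> 'a set \<Rightarrow> 'a list \<Rightarrow> bool" where
  "arc_path p V xs \<longleftrightarrow> distinct xs \<and>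
     successively (\<lambda>x y. \<exists>v\<in>V. {x, y} = {v, p v}) xs"

lemma rooted_tree_path:
  assumes "rooted_tree r U p S" "a \<in> U" "b \<in> U"
  shows "\<exists>xs. xs \<noteq> [] \<and> hd xs = a \<and> last xs = b \<and> set xs \<subseteq> U \<and> arc_path p (U - {r}) xs"
  using assms
proof (induction arbitrary: a b rule: rooted_tree.induct)
  case (root p)
  then show ?case by (intro exI[of _ "[r]"]) (auto simp: arc_path_def)
next
  case (leaf U p S u w)
  have r: "r \<in> U" using rooted_tree_basic leaf.hyps by metis
  let ?p = "p(w := u)" and ?V = "insert w U - {r}"
  have lift: "successively (\<lambda>x y. \<exists>v\<in>?V. {x, y} = {v, ?p v}) xs"
    if "arc_path p (U - {r}) xs" for xs
  proof -
    have step: "\<exists>v\<in>?V. {x, y} = {v, ?p v}" if "\<exists>v\<in>U - {r}. {x, y} = {v, p v}" for x y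
    proof -
      from that obtain v where v: "v \<in> U - {r}" "{x, y} = {v, p v}" ..
      then have "v \<in> ?V" "?p v = p v" using leaf.hyps by auto
      then show ?thesis using v(2) by metis
    qed
    from that have "successively (\<lambda>x y. \<exists>v\<in>U - {r}. {x, y} = {v, p v}) xs"
      by (simp add: arc_path_def)
    then show ?thesis by (rule successively_mono) (rule step)
  qed
  have new: "\<exists>v\<in>?V. {w, u} = {v, ?p v}" "\<exists>v\<in>?V. {u, w} = {v, ?p v}"
    by (rule bexI[of _ w]; use leaf.hyps r in \<open>auto simp: insert_commute\<close>)+
  consider "a \<in> U" "b \<in> U" | "a = w" "b \<in> U" | "a \<in> U" "b = w" | "a = w" "b = w"
    using leaf.prems by blast
  then show ?case
  proof cases
    case 1
    from leaf.IH[OF this] lift show ?thesis unfolding arc_path_def by blast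
  next
    case 2
    obtain xs where xs: "xs \<noteq> []" "hd xs = u" "last xs = b" "set xs \<subseteq> U" "arc_path p (U - {r}) xs"
      using leaf.IH[OF leaf.hyps(2) 2(2)] by blast
    show ?thesis
      by (intro exI[of _ "w # xs"])
         (use xs lift[OF xs(5)] new leaf.hyps 2 in \<open>auto simp: arc_path_def successively_Cons\<close>)
  next
    case 3
    obtain xs where xs: "xs \<noteq> []" "hd xs = a" "last xs = u" "set xs \<subseteq> U" "arc_path p (U - {r}) xs"
      using leaf.IH[OF 3(1) leaf.hyps(2)] by blast
    show ?thesis
      by (intro exI[of _ "xs @ [w]"])
         (use xs lift[OF xs(5)] new leaf.hyps 3 in \<open>auto simp: arc_path_def successively_append_iff\<close>)
  next
    case 4
    show ?thesis by (intro exI[of _ "[w]"]) (use 4 in \<open>auto simp: arc_path_def\<close>)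
  qed
qed

text \<open>
  A second edge from \<open>w\<close> into the part already rooted would close a cycle with the tree path
  between the two neighbours of \<open>w\<close>.
\<close>
lemma attaching_edge_unique:
  assumes T: "rooted_tree r U p S" and arcs: "(\<lambda>v. {v, p v}) ` (U - {r}) \<subseteq> E"
    and acyclic: "\<not> (\<exists>c. graph_cycle E c)"
    and "a \<in> U" "b \<in> U" "w \<notin> U" "{a, w} \<in> E" "{b, w} \<in> E"
  shows "a = b"
proof (rule ccontr)
  assume ab: "a \<noteq> b"
  obtain xs where xs: "xs \<noteq> []" "hd xs = a" "last xs = b" "set xs \<subseteq> U"
      "distinct xs" "successively (\<lambda>x y. \<exists>v\<in>U - {r}. {x, y} = {v, p v}) xs"
    using rooted_tree_path[OF T assms(4,5)] unfolding arc_path_def by blast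
  have len: "length xs \<ge> 2"
    using xs(1-3) ab by (cases xs; cases "tl xs") auto
  \<comment> \<open>The tree path from \<open>a\<close> to \<open>b\<close>, closed up through \<open>w\<close>.\<close>
  have "graph_cycle E (xs @ [w])"
    unfolding graph_cycle_def
  proof (intro conjI allI impI)
    fix i assume i: "i < length (xs @ [w])"
    consider "Suc i < length xs" | "Suc i = length xs" | "i = length xs" using i by force
    then show "{(xs @ [w]) ! i, (xs @ [w]) ! ((i + 1) mod length (xs @ [w]))} \<in> E"
    proof cases
      case 1
      then have "\<exists>v\<in>U - {r}. {xs ! i, xs ! Suc i} = {v, p v}"
        using xs(6) by (auto simp: successively_conv_nth)
      then show ?thesis using arcs 1 by (auto simp: nth_append)
    next
      case 2
      then have "xs ! i = b" using xs(1,3) by (simp add: last_conv_nth flip: 2)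
      then show ?thesis using 2 assms(8) by (auto simp: nth_append)
    next
      case 3
      then show ?thesis using xs(1,2) assms(7) by (auto simp: nth_append hd_conv_nth insert_commute)
    qed
  qed (use len xs assms(6) in auto)
  with acyclic show False by blast
qed

lemma connected_crossing_edge:
  assumes conn: "graph_connected n E" and "x \<in> U" "x < n" "y \<notin> U" "y < n"
  obtains a b where "a \<in> U" "b \<notin> U" "{a, b} \<in> E"
proof -
  have "(x, y) \<in> {(x, y). {x, y} \<in> E}\<^sup>*" using assms unfolding graph_connected_def by auto
  then have "y \<in> U \<or> (\<exists>a b. a \<in> U \<and> b \<notin> U \<and> {a, b} \<in> E)"
    by (induction rule: rtrancl_induct) (use \<open>x \<in> U\<close> in blast)+
  then show thesis using that assms by blast
qed

text \<open>
  Connectedness supplies an edge that leaves the part rooted so far, and acyclicity guarantees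
  that the new vertex brings in no further edge, so the rooted part remains an induced subgraph.
\<close>
lemma partial_rooting:
  assumes tree: "is_tree n E" and "1 \<le> k" "k \<le> n"
  shows "\<exists>U p S. rooted_tree 0 U p S \<and> U \<subseteq> {0..<n} \<and> card U = k \<and>
    {e \<in> E. e \<subseteq> U} = (\<lambda>v. {v, p v}) ` (U - {0})"
  using assms(2,3)
proof (induction k rule: nat_induct_at_least)
  case base
  have "e \<notin> E" if "e \<subseteq> {0}" for e
  proof -
    have "card e \<le> 1" using card_mono[OF _ that] by simp
    then show ?thesis using tree by (auto simp: is_tree_def simple_graph_def)
  qed
  then show ?case using base
    by (intro exI[of _ "{0}"] exI[of _ "\<lambda>_. 0"] exI[of _ "\<lambda>_. {}"]) (auto intro: root)
next
  case (Suc k)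
  have "k \<le> n" using Suc.prems by simp
  from Suc.IH[OF this] obtain U p S where T: "rooted_tree 0 U p S" and U: "U \<subseteq> {0..<n}" "card U = k"
    and edges: "{e \<in> E. e \<subseteq> U} = (\<lambda>v. {v, p v}) ` (U - {0})" by blast
  have fin: "finite U" and 0: "0 \<in> U" using rooted_tree_basic[OF T] by auto
  have "U \<noteq> {0..<n}" using U(2) Suc.prems by auto
  then obtain y where "y \<in> {0..<n}" "y \<notin> U" using U(1) by blast
  then have "y < n" "y \<notin> U" by auto
  moreover have "graph_connected n E" using tree by (simp add: is_tree_def)
  ultimately obtain u w where uw: "u \<in> U" "w \<notin> U" "{u, w} \<in> E"
    using connected_crossing_edge[of n E 0 U y] 0 U(1) by auto
  have w: "w < n" using tree uw(3) by (auto simp: is_tree_def simple_graph_def)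
  define S' where "S' = (\<lambda>v. if v = w then {w} else if u \<in> S v then insert w (S v) else S v)"
  have "{e \<in> E. e \<subseteq> insert w U} = insert {w, u} {e \<in> E. e \<subseteq> U}"
  proof (intro equalityI subsetI)
    fix e assume e: "e \<in> {e \<in> E. e \<subseteq> insert w U}"
    show "e \<in> insert {w, u} {e \<in> E. e \<subseteq> U}"
    proof (cases "w \<in> e")
      case True
      have "card e = 2" using tree e by (auto simp: is_tree_def simple_graph_def)
      then obtain b where b: "e = {b, w}" "b \<noteq> w" using True by (auto simp: card_2_iff)
      have "b = u"
        using attaching_edge_unique[OF T _ _ _ uw(1,2) _ uw(3), of b] edges tree b e
        by (auto simp: is_tree_def)
      then show ?thesis using b by auto
    qed (use e in auto)
  qed (use uw in \<open>auto simp: insert_commute\<close>)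
  also have "\<dots> = (\<lambda>v. {v, (p(w := u)) v}) ` (insert w U - {0})"
    unfolding edges using uw 0 by (auto simp: image_iff)
  finally have "{e \<in> E. e \<subseteq> insert w U} = (\<lambda>v. {v, (p(w := u)) v}) ` (insert w U - {0})" .
  moreover have "rooted_tree 0 (insert w U) (p(w := u)) S'"
    unfolding S'_def using leaf[OF T uw(1,2)] .
  moreover have "insert w U \<subseteq> {0..<n}" "card (insert w U) = Suc k"
    using U w uw fin by auto
  ultimately show ?case by blast
qed

lemma tree_rooting:
  assumes tree: "is_tree n E"
  obtains p S where "rooted_tree 0 {0..<n} p S" "E = (\<lambda>v. {v, p v}) ` ({0..<n} - {0})"
proof -
  have n: "1 \<le> n" using tree by (auto simp: is_tree_def graph_connected_def)
  obtain U p S where U: "rooted_tree 0 U p S" "U \<subseteq> {0..<n}" "card U = n"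
    "{e \<in> E. e \<subseteq> U} = (\<lambda>v. {v, p v}) ` (U - {0})"
    using partial_rooting[OF tree n order.refl] by blast
  have "U = {0..<n}" using U by (simp add: card_subset_eq)
  moreover have "{e \<in> E. e \<subseteq> {0..<n}} = E" using tree by (auto simp: is_tree_def simple_graph_def)
  ultimately show thesis using that U by metis
qed

section \<open>The sum of the products of the two sides of every edge\<close>

text \<open>
  The edges whose removal separates \<open>x\<close> from \<open>y\<close>. These are the edges of the path between them, so
  their number is the distance of \<open>x\<close> and \<open>y\<close>.
\<close>
definition separators :: "'a set \<Rightarrow> ('a \<Rightarrow> 'a set) \<Rightarrow> 'a \<Rightarrow> 'a \<Rightarrow> 'a set" where
  "separators V S x y = {v \<in> V. (x \<in> S v) \<noteq> (y \<in> S v)}"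

text \<open>
  The path maximises both the distance sum from one vertex and the Wiener index. In the
  induction over leaves the two statements support each other: the new leaf is one step farther from every
  old vertex than its parent is, and any distance is at most the number of edges.
\<close>
lemma separators_sum_bounds:
  assumes "rooted_tree r U p S"
  defines "d \<equiv> (\<lambda>x y. real (card (separators (U - {r}) S x y)))"
  shows "x \<in> U \<Longrightarrow> (\<Sum>y\<in>U. d x y) \<le> real (card U) * (real (card U) - 1) / 2"
    and "(\<Sum>x\<in>U. \<Sum>y\<in>U. d x y) \<le> real (card U) * ((real (card U))\<^sup>2 - 1) / 3"
  using assms(1) unfolding d_def
proof (induction arbitrary: x rule: rooted_tree.induct)
  case (root p)
  { case 1 then show ?case by (simp add: separators_def) }
  { case 2 then show ?case by (simp add: separators_def) }
next
  case (leaf U p S u w)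
  define S' where "S' = (\<lambda>v. if v = w then {w} else if u \<in> S v then insert w (S v) else S v)"
  define d where "d = (\<lambda>x y. real (card (separators (U - {r}) S x y)))"
  define d' where "d' = (\<lambda>x y. real (card (separators (insert w U - {r}) S' x y)))"
  define k where "k = real (card U)"
  have fin: "finite U" and r: "r \<in> U" using rooted_tree_basic[OF leaf.hyps(1)] by auto
  have k': "real (card (insert w U)) = k + 1" using fin leaf.hyps by (simp add: k_def)
  have sub: "w \<notin> S v" if "v \<in> U - {r}" for v
    using subtree_bounds(5)[OF leaf.hyps(1) that] leaf.hyps by auto
  have old: "d' x y = d x y" if "x \<in> U" "y \<in> U" for x y
  proof -
    have "separators (insert w U - {r}) S' x y = separators (U - {r}) S x y"
      using that leaf.hyps by (auto simp: separators_def S'_def split: if_splits)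
    then show ?thesis by (simp add: d_def d'_def)
  qed
  have new: "d' w y = d u y + 1" if "y \<in> U" for y
  proof -
    have "separators (insert w U - {r}) S' w y = insert w (separators (U - {r}) S u y)"
      using that leaf.hyps sub r by (auto simp: separators_def S'_def split: if_splits)
    moreover have "w \<notin> separators (U - {r}) S u y" "finite (separators (U - {r}) S u y)"
      using leaf.hyps fin by (auto simp: separators_def)
    ultimately show ?thesis by (simp add: d_def d'_def)
  qed
  have sym: "d' x y = d' y x" for x y
    unfolding d'_def separators_def by (rule arg_cong[where f = "\<lambda>A. real (card A)"]) auto
  have diag: "d' w w = 0" by (simp add: d'_def separators_def)
  have d_le: "d x y \<le> k - 1" for x y
  proof -
    have "card (separators (U - {r}) S x y) \<le> card (U - {r})"
      using fin by (intro card_mono) (auto simp: separators_def)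
    then show ?thesis using real_card_edges[OF leaf.hyps(1)] by (simp add: d_def k_def)
  qed
  have row: "(\<Sum>y\<in>U. d x y) \<le> k * (k - 1) / 2" if "x \<in> U" for x
    using leaf.IH(1)[OF that] by (simp add: d_def k_def)
  have total: "(\<Sum>x\<in>U. \<Sum>y\<in>U. d x y) \<le> k * (k\<^sup>2 - 1) / 3"
    using leaf.IH(2) by (simp add: d_def k_def)
  have row_w: "(\<Sum>y\<in>U. d' w y) \<le> k * (k + 1) / 2"
  proof -
    have "(\<Sum>y\<in>U. d' w y) = (\<Sum>y\<in>U. d u y) + k"
      using new by (simp add: sum.distrib k_def)
    then show ?thesis using row[OF leaf.hyps(2)] by (simp add: field_simps)
  qed
  { case 1
    have "(\<Sum>y\<in>insert w U. d' x y) \<le> k * (k + 1) / 2"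
    proof (cases "x = w")
      case True
      then show ?thesis using row_w diag fin leaf.hyps by simp
    next
      case False
      then have x: "x \<in> U" using 1 by simp
      have "(\<Sum>y\<in>insert w U. d' x y) = d u x + 1 + (\<Sum>y\<in>U. d x y)"
        using x old new sym[of x w] fin leaf.hyps by simp
      then show ?thesis using row[OF x] d_le[of u x] by (simp add: field_simps)
    qed
    then show ?case unfolding d'_def S'_def k' by (simp add: mult.commute) }
  { case 2
    have "(\<Sum>x\<in>insert w U. \<Sum>y\<in>insert w U. d' x y)
        = (\<Sum>x\<in>U. \<Sum>y\<in>U. d x y) + 2 * (\<Sum>y\<in>U. d' w y)"
    proof -
      have "(\<Sum>y\<in>insert w U. d' x y) = d' w x + (\<Sum>y\<in>U. d x y)" if "x \<in> U" for x
        using that fin leaf.hyps old sym[of x w] by simp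
      moreover have "(\<Sum>y\<in>insert w U. d' w y) = (\<Sum>y\<in>U. d' w y)"
        using fin leaf.hyps diag by simp
      moreover have "(\<Sum>x\<in>insert w U. \<Sum>y\<in>insert w U. d' x y)
          = (\<Sum>y\<in>insert w U. d' w y) + (\<Sum>x\<in>U. \<Sum>y\<in>insert w U. d' x y)"
        using fin leaf.hyps(3) by (rule sum.insert)
      ultimately show ?thesis by (simp add: sum.distrib)
    qed
    also have "\<dots> \<le> k * (k\<^sup>2 - 1) / 3 + k * (k + 1)" using total row_w by simp
    also have "\<dots> = (k + 1) * ((k + 1)\<^sup>2 - 1) / 3" by (simp add: field_simps power2_eq_square)
    finally show ?case unfolding d'_def S'_def k' . }
qed

text \<open>
  An edge with \<open>s\<close> vertices below it separates \<open>s * (n - s)\<close> pairs of vertices, so double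
  counting turns the left-hand side into the Wiener index.
\<close>
lemma sum_cut_sizes_le:
  assumes T: "rooted_tree r U p S"
  shows "(\<Sum>v\<in>U - {r}. real (card (S v)) * (real (card U) - real (card (S v))))
     \<le> real (card U) * ((real (card U))\<^sup>2 - 1) / 6"
proof -
  have fin: "finite U" using rooted_tree_basic[OF T] by auto
  have "2 * (real (card (S v)) * (real (card U) - real (card (S v))))
      = (\<Sum>x\<in>U. \<Sum>y\<in>U. of_bool ((x \<in> S v) \<noteq> (y \<in> S v)))" if v: "v \<in> U - {r}" for v
  proof -
    have sub: "S v \<subseteq> U" using subtree_bounds(5)[OF T v] by auto
    have U: "U = S v \<union> (U - S v)" "S v \<inter> (U - S v) = {}" "finite (S v)"
      using sub fin finite_subset by auto
    have c: "real (card (U - S v)) = real (card U) - real (card (S v))"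
      using sub fin U by (simp add: card_Diff_subset card_mono of_nat_diff)
    have inner: "(\<Sum>y\<in>U. of_bool ((x \<in> S v) \<noteq> (y \<in> S v)) :: real)
        = (if x \<in> S v then real (card (U - S v)) else real (card (S v)))" for x
    proof -
      have "(\<Sum>y\<in>U. of_bool ((x \<in> S v) \<noteq> (y \<in> S v)) :: real)
          = real (card {y \<in> U. (x \<in> S v) \<noteq> (y \<in> S v)})"
        using fin by (simp add: sum_of_bool_eq Int_def)
      also have "{y \<in> U. (x \<in> S v) \<noteq> (y \<in> S v)} = (if x \<in> S v then U - S v else S v)"
        using sub by auto
      finally show ?thesis by simp
    qed
    have "(\<Sum>x\<in>U. if x \<in> S v then real (card (U - S v)) else real (card (S v)))
        = (\<Sum>x\<in>S v. real (card (U - S v))) + (\<Sum>x\<in>U - S v. real (card (S v)))"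
      using fin sub by (subst sum.subset_diff[OF sub fin]) (simp add: add.commute)
    then show ?thesis unfolding inner by (simp add: c)
  qed
  then have "2 * (\<Sum>v\<in>U - {r}. real (card (S v)) * (real (card U) - real (card (S v))))
      = (\<Sum>v\<in>U - {r}. \<Sum>x\<in>U. \<Sum>y\<in>U. of_bool ((x \<in> S v) \<noteq> (y \<in> S v)))"
    by (simp add: sum_distrib_left)
  also have "\<dots> = (\<Sum>x\<in>U. \<Sum>y\<in>U. \<Sum>v\<in>U - {r}. of_bool ((x \<in> S v) \<noteq> (y \<in> S v)))"
    by (subst sum.swap) (intro sum.cong refl sum.swap)
  also have "\<dots> = (\<Sum>x\<in>U. \<Sum>y\<in>U. real (card (separators (U - {r}) S x y)))"
    using fin by (intro sum.cong refl) (simp add: separators_def sum_of_bool_eq Int_def)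
  also have "\<dots> \<le> real (card U) * ((real (card U))\<^sup>2 - 1) / 3"
    by (rule separators_sum_bounds(2)[OF T])
  finally show ?thesis by simp
qed

section \<open>Eigenvalues of Gram matrices and of inverse matrices\<close>

text \<open>
  If \<open>v\<close> is an eigenvector of \<open>R * R\<^sup>T\<close> for \<open>e\<close>, then \<open>e\<close> times the squared norm of \<open>v\<close> is the
  squared norm of \<open>R\<^sup>T v\<close>, as \<open>R\<close> is real.
\<close>
lemma eigenvalue_gram_nonneg:
  fixes R :: "complex mat"
  assumes R: "R \<in> carrier_mat n m"
    and real: "\<And>i j. i < n \<Longrightarrow> j < m \<Longrightarrow> R $$ (i, j) \<in> \<real>"
    and ev: "eigenvalue (R * R\<^sup>T) e"
  shows "e \<in> \<real> \<and> 0 \<le> Re e"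
proof -
  obtain v where v: "v \<in> carrier_vec n" "v \<noteq> 0\<^sub>v n" and eq: "(R * R\<^sup>T) *\<^sub>v v = e \<cdot>\<^sub>v v"
    using ev R unfolding eigenvalue_def eigenvector_def by auto
  define w where "w = R\<^sup>T *\<^sub>v v"
  have w: "w \<in> carrier_vec m" using R v unfolding w_def by auto
  have cw: "conjugate w = R\<^sup>T *\<^sub>v conjugate v"
  proof (rule eq_vecI)
    fix j assume "j < dim_vec (R\<^sup>T *\<^sub>v conjugate v)"
    then have j: "j < m" using R by auto
    have "conjugate w $ j = (\<Sum>i = 0..<n. cnj (R $$ (i, j) * v $ i))"
      using j R v w by (simp add: w_def scalar_prod_def)
    also have "\<dots> = (\<Sum>i = 0..<n. R $$ (i, j) * cnj (v $ i))"
      using real j by (intro sum.cong) (auto simp: Reals_cnj_iff)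
    finally show "conjugate w $ j = (R\<^sup>T *\<^sub>v conjugate v) $ j"
      using j R v by (simp add: scalar_prod_def)
  qed (use R w in auto)
  have "e * (v \<bullet>c v) = ((R * R\<^sup>T) *\<^sub>v v) \<bullet>c v"
    using v by (simp add: eq)
  also have "(R * R\<^sup>T) *\<^sub>v v = R *\<^sub>v w"
    using R v unfolding w_def by (intro assoc_mult_mat_vec) auto
  also have "(R *\<^sub>v w) \<bullet>c v = w \<bullet> (R\<^sup>T *\<^sub>v conjugate v)"
  proof -
    have "(R *\<^sub>v w) \<bullet> conjugate v = (\<Sum>i = 0..<n. \<Sum>j = 0..<m. R $$ (i, j) * w $ j * conjugate v $ i)"
      using R v w by (simp add: scalar_prod_def sum_distrib_right)
    also have "\<dots> = (\<Sum>j = 0..<m. \<Sum>i = 0..<n. R $$ (i, j) * w $ j * conjugate v $ i)"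
      by (rule sum.swap)
    also have "\<dots> = w \<bullet> (R\<^sup>T *\<^sub>v conjugate v)"
      using R v w by (simp add: scalar_prod_def sum_distrib_left mult_ac)
    finally show ?thesis .
  qed
  finally have *: "e * (v \<bullet>c v) = w \<bullet>c w" by (simp add: cw)
  have pos: "v \<bullet>c v > 0" using v by simp
  then obtain r where r: "v \<bullet>c v = complex_of_real r" "r > 0"
    by (intro that[of "Re (v \<bullet>c v)"]) (auto simp: less_complex_def complex_eq_iff)
  have "w \<bullet>c w \<ge> 0" by blast
  then obtain s where s: "w \<bullet>c w = complex_of_real s" "s \<ge> 0"
    by (intro that[of "Re (w \<bullet>c w)"]) (auto simp: less_eq_complex_def complex_eq_iff)
  have "e = complex_of_real (s / r)"
    using * r s by (simp add: field_simps)
  then show ?thesis using r s by simp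
qed

text \<open>
  Over the complex numbers every characteristic polynomial splits, and for a Gram matrix the
  roots are real and nonnegative, so the factorisation descends to the reals.
\<close>
lemma char_poly_gram_splits:
  fixes R :: "real mat"
  assumes R: "R \<in> carrier_mat n m"
  obtains es where "char_poly (R * R\<^sup>T) = (\<Prod>e\<leftarrow>es. [:- e, 1:])"
    and "length es = n" and "\<And>e. e \<in> set es \<Longrightarrow> e \<ge> 0"
proof -
  let ?c = "map_mat complex_of_real"
  interpret of_real_poly: map_poly_inj_comm_ring_hom complex_of_real ..
  define G where "G = R * R\<^sup>T"
  have G: "G \<in> carrier_mat n n" using R unfolding G_def by auto
  obtain cs where cs: "char_poly (?c G) = (\<Prod>e\<leftarrow>cs. [:- e, 1:])" "length cs = n"
    using char_poly_factorized[of "?c G" n] G by auto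
  have cG: "?c G = ?c R * (?c R)\<^sup>T"
  proof -
    have "?c G = ?c R * ?c (R\<^sup>T)"
      unfolding G_def by (rule of_real_hom.mat_hom_mult[OF R]) (use R in auto)
    also have "?c (R\<^sup>T) = (?c R)\<^sup>T" by (rule eq_matI) auto
    finally show ?thesis .
  qed
  have nonneg: "e \<in> \<real> \<and> 0 \<le> Re e" if "e \<in> set cs" for e
  proof -
    have "poly (char_poly (?c G)) e = 0"
      unfolding cs poly_prod_list prod_list_zero_iff using that by (auto simp: image_iff)
    then have "eigenvalue (?c G) e"
      using eigenvalue_root_char_poly[of "?c G" n e] G by auto
    then show ?thesis
      unfolding cG by (intro eigenvalue_gram_nonneg[of _ n m]) (use R in auto)
  qed
  define es where "es = map Re cs"
  have "map_poly complex_of_real (char_poly G) = (\<Prod>e\<leftarrow>cs. [:- e, 1:])"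
    using cs(1) by (simp add: of_real_hom.char_poly_hom[OF G])
  also have "\<dots> = (\<Prod>e\<leftarrow>es. map_poly complex_of_real [:- e, 1:])"
    unfolding es_def map_map
    by (rule arg_cong[where f = prod_list], rule map_cong[OF refl])
       (use nonneg in \<open>auto simp: complex_is_Real_iff complex_eq_iff\<close>)
  also have "\<dots> = map_poly complex_of_real (\<Prod>e\<leftarrow>es. [:- e, 1:])"
    by (simp add: of_real_poly.hom_prod_list o_def)
  finally have "char_poly G = (\<Prod>e\<leftarrow>es. [:- e, 1:])" 
    by simp
  then show thesis
    using that[of es] cs(2) nonneg unfolding es_def G_def by auto
qed

text \<open>
  Power sums of the inverse eigenvalues of \<open>K\<close> can be read off from the entries of \<open>N\<close>. A
  Schur decomposition replaces \<open>N\<close> by an upper triangular \<open>T\<close> and \<open>K\<close> by an inverse \<open>S\<close> of \<open>T\<close>. Then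
  \<open>(X - S) * T = X * T - 1\<close> is triangular, and its determinant gives the characteristic polynomial of
  \<open>S\<close>; and the trace of \<open>N * N\<close> equals that of \<open>T * T\<close>.
\<close>
lemma inverse_char_poly_and_square_sum:
  fixes N K :: "'a :: conjugatable_ordered_field mat"
  assumes N: "N \<in> carrier_mat n n" and K: "K \<in> carrier_mat n n" and KN: "K * N = 1\<^sub>m n"
    and cp: "char_poly N = (\<Prod>e\<leftarrow>es. [:- e, 1:])"
  shows "char_poly K = (\<Prod>e\<leftarrow>es. [:- (1 / e), 1:])"
    and "(\<Sum>e\<leftarrow>es. e\<^sup>2) = (\<Sum>i<n. \<Sum>j<n. N $$ (i, j) * N $$ (j, i))"
    and "0 \<notin> set es"
proof -
  obtain T P Q where schur: "schur_decomposition N es = (T, P, Q)"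
    by (cases "schur_decomposition N es") auto
  note S = schur_decomposition[OF N cp schur]
  then have ut: "upper_triangular T" and diag: "diag_mat T = es" by auto
  from S have "similar_mat_wit N T P Q" by auto
  from similar_mat_witD2[OF N this]
  have PQ: "P * Q = 1\<^sub>m n" "Q * P = 1\<^sub>m n" and NT: "N = P * T * Q"
    and T: "T \<in> carrier_mat n n" and P: "P \<in> carrier_mat n n" and Q: "Q \<in> carrier_mat n n" by auto
  define S where "S = Q * K * P"
  have Sc: "S \<in> carrier_mat n n" using Q K P unfolding S_def by auto
  note assoc = assoc_mult_mat[of _ n n _ n _ n]
  have TN: "T = Q * N * P"
  proof -
    have "Q * N * P = (Q * P) * T * (Q * P)"
      unfolding NT using P Q T by (simp add: assoc)
    then show ?thesis using PQ T by simp
  qed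
  have ST: "S * T = 1\<^sub>m n"
  proof -
    have "S * T = Q * (K * ((P * Q) * (N * P)))"
      unfolding TN S_def using P Q K N by (simp add: assoc)
    also have "\<dots> = Q * ((K * N) * P)"
      using PQ P Q K N by (simp add: assoc)
    finally show ?thesis using PQ KN P Q by simp
  qed
  have len: "length es = n" using diag T by (auto simp: diag_mat_def)
  have Td: "T $$ (i, i) = es ! i" if "i < n" for i
    using that T unfolding diag[symmetric] by (auto simp: diag_mat_def)
  have detT: "det T = prod_list es" using det_upper_triangular[OF ut T] diag by simp
  have "det S * det T = 1" using det_mult[OF Sc T] ST by simp
  then have "det T \<noteq> 0" by auto
  then show nz: "0 \<notin> set es" by (auto simp: detT prod_list_zero_iff)
  have cps: "char_poly K = char_poly S"
  proof (rule char_poly_similar, rule similar_matI[of _ _ P Q n])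
    have "P * S * Q = (P * Q) * K * (P * Q)"
      unfolding S_def using P Q K by (simp add: assoc)
    then show "K = P * S * Q" using PQ K by simp
  qed (use P Q Sc K PQ in auto)
  let ?m = "map_mat (\<lambda>a. [:a:])"
  \<comment> \<open>The characteristic matrix of \<open>S\<close> times \<open>T\<close>, multiplied out with \<open>S * T = 1\<close>.\<close>
  define W where "W = mat n n (\<lambda>(i, j). (if i = j then [:-1:] else 0) + [:0, T $$ (i, j):])"
  have W: "W \<in> carrier_mat n n" unfolding W_def by auto
  have "char_poly_matrix S * ?m T = W"
  proof (rule eq_matI)
    fix i j assume "i < dim_row W" "j < dim_col W"
    then have ij: "i < n" "j < n" using W by auto
    have "(char_poly_matrix S * ?m T) $$ (i, j)
        = (\<Sum>k<n. ((if i = k then [:0, 1:] else 0) + [:- S $$ (i, k):]) * [:T $$ (k, j):])"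
      using ij Sc T by (auto simp: char_poly_matrix_def scalar_prod_def lessThan_atLeast0 intro!: sum.cong)
    also have "\<dots> = (\<Sum>k<n. (if i = k then [:0, T $$ (k, j):] else 0) + [:- (S $$ (i, k) * T $$ (k, j)):])"
      by (intro sum.cong) (auto simp: algebra_simps)
    also have "\<dots> = [:0, T $$ (i, j):] + (\<Sum>k<n. [:- (S $$ (i, k) * T $$ (k, j)):])"
      using ij by (simp add: sum.distrib)
    also have "(\<Sum>k<n. [:- (S $$ (i, k) * T $$ (k, j)):]) = [:- (\<Sum>k<n. S $$ (i, k) * T $$ (k, j)):]"
      by (induction n) (auto simp: )
    also have "(\<Sum>k<n. S $$ (i, k) * T $$ (k, j)) = (S * T) $$ (i, j)"
      using ij Sc T by (simp add: scalar_prod_def lessThan_atLeast0)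
    finally show "(char_poly_matrix S * ?m T) $$ (i, j) = W $$ (i, j)"
      using ij by (auto simp: W_def ST)
  qed (use Sc T W char_poly_matrix_closed[OF Sc] in \<open>auto simp del: char_poly_matrix_closed\<close>)
  then have "char_poly S * det (?m T) = det W"
    unfolding char_poly_def using det_mult[of "char_poly_matrix S" n "?m T"] Sc T by auto
  also have "det (?m T) = prod_list (map (\<lambda>a. [:a:]) es)"
  proof -
    have "det (?m T) = prod_list (diag_mat (?m T))"
      by (rule det_upper_triangular[of _ n]) (use ut T in \<open>auto simp: upper_triangular_def\<close>)
    also have "diag_mat (?m T) = map (\<lambda>a. [:a:]) es"
      using T unfolding diag[symmetric] by (auto simp: diag_mat_def)
    finally show ?thesis .
  qed
  also have "det W = prod_list (map (\<lambda>a. [:-1, a:]) es)"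
  proof -
    have "det W = prod_list (diag_mat W)"
      by (rule det_upper_triangular[OF _ W]) (use ut T in \<open>auto simp: upper_triangular_def W_def\<close>)
    also have "diag_mat W = map (\<lambda>a. [:-1, a:]) es"
      using T unfolding diag[symmetric] by (auto simp: diag_mat_def W_def)
    finally show ?thesis .
  qed
  also have "prod_list (map (\<lambda>a. [:-1, a:]) es)
      = (\<Prod>e\<leftarrow>es. [:- (1 / e), 1:]) * prod_list (map (\<lambda>a. [:a:]) es)"
    using nz by (induction es) (auto simp: algebra_simps)
  finally show "char_poly K = (\<Prod>e\<leftarrow>es. [:- (1 / e), 1:])"
    using nz unfolding cps by (auto simp: prod_list_zero_iff)
  have tr: "(\<Sum>i<n. (X * Y) $$ (i, i)) = (\<Sum>i<n. (Y * X) $$ (i, i))"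
    if "X \<in> carrier_mat n n" "Y \<in> carrier_mat n n" for X Y :: "'a mat"
  proof -
    have "(\<Sum>i<n. (X * Y) $$ (i, i)) = (\<Sum>i<n. \<Sum>j<n. X $$ (i, j) * Y $$ (j, i))"
      using that by (simp add: scalar_prod_def lessThan_atLeast0)
    also have "\<dots> = (\<Sum>j<n. \<Sum>i<n. X $$ (i, j) * Y $$ (j, i))" by (rule sum.swap)
    also have "\<dots> = (\<Sum>i<n. (Y * X) $$ (i, i))"
      using that by (simp add: scalar_prod_def lessThan_atLeast0 mult.commute)
    finally show ?thesis .
  qed
  have "(\<Sum>i<n. \<Sum>j<n. N $$ (i, j) * N $$ (j, i)) = (\<Sum>i<n. (N * N) $$ (i, i))"
    using N by (simp add: scalar_prod_def lessThan_atLeast0)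
  also have "N * N = P * T * ((Q * P) * (T * Q))"
    unfolding NT using P Q T by (simp add: assoc)
  also have "\<dots> = P * (T * T * Q)"
    using P Q T PQ by (simp add: assoc)
  also have "(\<Sum>i<n. (P * (T * T * Q)) $$ (i, i)) = (\<Sum>i<n. ((T * T * Q) * P) $$ (i, i))"
    by (rule tr) (use P Q T in auto)
  also have "(T * T * Q) * P = T * T"
    using P Q T PQ by (simp add: assoc)
  also have "(\<Sum>i<n. (T * T) $$ (i, i)) = (\<Sum>i<n. (es ! i)\<^sup>2)"
  proof (rule sum.cong[OF refl])
    fix i assume "i \<in> {..<n}"
    then have i: "i < n" by simp
    have "(T * T) $$ (i, i) = (\<Sum>j<n. T $$ (i, j) * T $$ (j, i))"
      using i T by (simp add: scalar_prod_def lessThan_atLeast0)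
    also have "\<dots> = (\<Sum>j<n. if j = i then T $$ (i, i) * T $$ (i, i) else 0)"
      using ut T i by (intro sum.cong) (auto simp: upper_triangular_def elim: linorder_neqE_nat)
    finally show "(T * T) $$ (i, i) = (es ! i)\<^sup>2" using i Td by (simp add: power2_eq_square)
  qed
  also have "\<dots> = (\<Sum>e\<leftarrow>es. e\<^sup>2)" by (simp add: sum_list_sum_nth len lessThan_atLeast0)
  finally show "(\<Sum>e\<leftarrow>es. e\<^sup>2) = (\<Sum>i<n. \<Sum>j<n. N $$ (i, j) * N $$ (j, i))" ..
qed

section \<open>The Laplacian spectrum in terms of edge cuts\<close>

lemma proots_linear_factors:
  fixes es :: "'a :: idom list"
  shows "proots (\<Prod>e\<leftarrow>es. [:- e, 1:]) = mset es"
proof (induction es)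
  case (Cons e es)
  have "(\<Prod>e\<leftarrow>es. [:- e, 1:]) \<noteq> 0" by (auto simp: prod_list_zero_iff)
  then have "proots ([:- e, 1:] * (\<Prod>e\<leftarrow>es. [:- e, 1:]))
      = proots [:- e, 1:] + proots (\<Prod>e\<leftarrow>es. [:- e, 1:])"
    by (intro proots_mult) auto
  then show ?case using Cons.IH by (simp del: mult_pCons_left)
qed simp

text \<open>
  As all roots are nonnegative, the entry \<open>0\<close> comes first in the sorted list and is the one that
  the summation range \<open>2..n\<close> leaves out.
\<close>
lemma inverse_square_eigenvalue_sum:
  assumes cp: "char_poly (laplacian n E) = [:0, 1:] * (\<Prod>e\<leftarrow>es. [:- e, 1:])"
    and len: "length es = n - 1" "n > 0" and nonneg: "\<And>e. e \<in> set es \<Longrightarrow> e \<ge> 0"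
  shows "(\<Sum>i = 2..n. 1 / (laplacian_eigenvalue n E i)\<^sup>2) = (\<Sum>e\<leftarrow>es. 1 / e\<^sup>2)"
proof -
  define xs where "xs = sort es"
  have "char_poly (laplacian n E) = (\<Prod>e\<leftarrow>0 # es. [:- e, 1:])" using cp by simp
  then have "proots (char_poly (laplacian n E)) = mset (0 # es)"
    by (simp only: proots_linear_factors)
  then have "sorted_list_of_multiset (proots (char_poly (laplacian n E))) = sort (0 # es)"
    by (simp only: sorted_list_of_multiset_mset)
  also have "\<dots> = 0 # xs"
    unfolding xs_def using nonneg by (simp add: insort_is_Cons)
  finally have "laplacian_eigenvalue n E i = (0 # xs) ! (i - 1)" for i
    by (simp add: laplacian_eigenvalue_def)
  then have "(\<Sum>i = 2..n. 1 / (laplacian_eigenvalue n E i)\<^sup>2) = (\<Sum>i = 0 + 2..<(n - 1) + 2. 1 / ((0 # xs) ! (i - 1))\<^sup>2)"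
    using len(2) by (intro sum.cong) auto
  also have "\<dots> = (\<Sum>i = 0..<n - 1. 1 / (xs ! i)\<^sup>2)"
    by (subst sum.shift_bounds_nat_ivl) simp
  also have "\<dots> = (\<Sum>e\<leftarrow>xs. 1 / e\<^sup>2)"
    using len(1) by (simp add: sum_list_sum_nth xs_def)
  also have "\<dots> = (\<Sum>e\<leftarrow>es. 1 / e\<^sup>2)"
    by (simp add: xs_def flip: sum_mset_sum_list) 
  finally show ?thesis .
qed

text \<open>
  If row \<open>0\<close> vanishes off the diagonal, clearing it exchanges the eigenvalue \<open>c\<close> for \<open>0\<close>: the rows
  \<open>0\<close> of the two characteristic matrices are \<open>X\<close> and \<open>X - c\<close> times a unit vector, and the other rows agree.
\<close>
lemma char_poly_clear_row:
  fixes K :: "'a :: idom mat"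
  assumes K: "K \<in> carrier_mat n n" and n: "n > 0"
    and row: "\<And>j. j < n \<Longrightarrow> K $$ (0, j) = (if j = 0 then c else 0)"
  shows "[:- c, 1:] * char_poly (multrow 0 0 K) = [:0, 1:] * char_poly K"
proof -
  have "multrow 0 [:- c, 1:] (char_poly_matrix (multrow 0 0 K)) = multrow 0 [:0, 1:] (char_poly_matrix K)"
    by (rule eq_matI) (use K row in \<open>auto simp: char_poly_matrix_def mat_multrow_def\<close>)
  then have "det (multrow 0 [:- c, 1:] (char_poly_matrix (multrow 0 0 K)))
      = det (multrow 0 [:0, 1:] (char_poly_matrix K))" by (rule arg_cong)
  then show ?thesis
    using n K by (simp add: det_multrow[of _ n] char_poly_def)
qed

text \<open>
  The oriented incidence matrix: the column of the edge \<open>v\<close> has \<open>1\<close> at \<open>v\<close> and \<open>-1\<close> at its parent.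
\<close>
definition edge_flow :: "('a \<Rightarrow> 'a) \<Rightarrow> 'a \<Rightarrow> 'a \<Rightarrow> real" where
  "edge_flow p x v = of_bool (x = v) - of_bool (x = p v)"

text \<open>
  The edges above \<open>y\<close> form the path from \<open>y\<close> to the root, and the sum of their incidence columns
  telescopes.
\<close>
lemma sum_edge_flow_subtree:
  assumes "rooted_tree r U p S" "y \<in> U"
  shows "(\<Sum>v\<in>U - {r}. edge_flow p x v * of_bool (y \<in> S v)) = of_bool (x = y) - of_bool (x = r)"
  using assms
proof (induction arbitrary: y rule: rooted_tree.induct)
  case (leaf U p S u w)
  define S' where "S' = (\<lambda>v. if v = w then {w} else if u \<in> S v then insert w (S v) else S v)"
  have fin: "finite U" and r: "r \<in> U" using rooted_tree_basic[OF leaf.hyps(1)] by auto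
  have sub: "w \<notin> S v" if "v \<in> U - {r}" for v
    using subtree_bounds(5)[OF leaf.hyps(1) that] leaf.hyps by auto
  have flow: "edge_flow (p(w := u)) x v = edge_flow p x v" if "v \<in> U - {r}" for v
    using that leaf.hyps by (auto simp: edge_flow_def)
  have flow_w: "edge_flow (p(w := u)) x w = of_bool (x = w) - of_bool (x = u)"
    by (simp add: edge_flow_def)
  have "insert w U - {r} = insert w (U - {r})" using r leaf.hyps by auto
  then have split: "(\<Sum>v\<in>insert w U - {r}. edge_flow (p(w := u)) x v * of_bool (y \<in> S' v))
      = edge_flow (p(w := u)) x w * of_bool (y = w)
        + (\<Sum>v\<in>U - {r}. edge_flow p x v * of_bool (y \<in> S' v))"
    using fin leaf.hyps flow by (simp add: S'_def)
  have "(\<Sum>v\<in>insert w U - {r}. edge_flow (p(w := u)) x v * of_bool (y \<in> S' v))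
      = of_bool (x = y) - of_bool (x = r)"
  proof (cases "y = w")
    case True
    have "(\<Sum>v\<in>U - {r}. edge_flow p x v * of_bool (y \<in> S' v))
        = (\<Sum>v\<in>U - {r}. edge_flow p x v * of_bool (u \<in> S v))"
      by (intro sum.cong refl) (use leaf.hyps sub True in \<open>auto simp: S'_def\<close>)
    then show ?thesis using True unfolding split flow_w leaf.IH[OF leaf.hyps(2)] by simp
  next
    case False
    then have y: "y \<in> U" using leaf.prems by simp
    have "(\<Sum>v\<in>U - {r}. edge_flow p x v * of_bool (y \<in> S' v))
        = (\<Sum>v\<in>U - {r}. edge_flow p x v * of_bool (y \<in> S v))"
      by (intro sum.cong refl) (use leaf.hyps False in \<open>auto simp: S'_def\<close>)
    then show ?thesis using False unfolding split leaf.IH[OF y] by simp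
  qed
  then show ?case unfolding S'_def .
qed auto

text \<open>
  The inverse of the edge matrix \<open>B\<^sup>T B\<close>, where \<open>B\<close> is the oriented incidence matrix.
\<close>
definition cut_gram :: "'a set \<Rightarrow> ('a \<Rightarrow> 'a set) \<Rightarrow> 'a \<Rightarrow> 'a \<Rightarrow> real" where
  "cut_gram U S v w = real (card (S v \<inter> S w)) - real (card (S v)) * real (card (S w)) / real (card U)"

text \<open>
  The indicator of \<open>S v\<close> minus its mean over \<open>U\<close>.
\<close>
definition centered :: "'a set \<Rightarrow> ('a \<Rightarrow> 'a set) \<Rightarrow> 'a \<Rightarrow> 'a \<Rightarrow> real" where
  "centered U S v y = of_bool (y \<in> S v) - real (card (S v)) / real (card U)"

text \<open>
  The incidence matrix times the matrix of centered indicators is the projection onto the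
  vectors of mean zero, which is the complement of the kernel of the Laplacian.
\<close>
lemma sum_edge_flow_centered:
  assumes T: "rooted_tree r U p S" and x: "x \<in> U" and y: "y \<in> U"
  shows "(\<Sum>v\<in>U - {r}. edge_flow p x v * centered U S v y) = of_bool (x = y) - 1 / real (card U)"
proof -
  have fin: "finite U" and r: "r \<in> U" using rooted_tree_basic[OF T] by auto
  have pos: "real (card U) > 0" using fin r by (auto simp: card_gt_0_iff)
  have "(\<Sum>v\<in>U - {r}. edge_flow p x v * real (card (S v)))
      = (\<Sum>v\<in>U - {r}. \<Sum>z\<in>U. edge_flow p x v * of_bool (z \<in> S v))"
  proof (intro sum.cong refl)
    fix v assume "v \<in> U - {r}"
    then have "S v \<subseteq> U" using subtree_bounds(5)[OF T] by blast
    then show "edge_flow p x v * real (card (S v)) = (\<Sum>z\<in>U. edge_flow p x v * of_bool (z \<in> S v))"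
      using fin by (simp add: sum_of_bool_eq Int_absorb1 flip: sum_distrib_left)
  qed
  also have "\<dots> = (\<Sum>z\<in>U. of_bool (x = z) - of_bool (x = r))"
    by (subst sum.swap) (simp add: sum_edge_flow_subtree[OF T])
  also have "\<dots> = 1 - real (card U) * of_bool (x = r)"
    using fin x by (simp add: sum_subtractf of_bool_def)
  finally have size: "(\<Sum>v\<in>U - {r}. edge_flow p x v * real (card (S v))) = 1 - real (card U) * of_bool (x = r)" .
  have "(\<Sum>v\<in>U - {r}. edge_flow p x v * centered U S v y)
      = (\<Sum>v\<in>U - {r}. edge_flow p x v * of_bool (y \<in> S v))
        - (\<Sum>v\<in>U - {r}. edge_flow p x v * real (card (S v))) / real (card U)"
    by (simp add: centered_def right_diff_distrib sum_subtractf sum_divide_distrib)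
  also have "\<dots> = of_bool (x = y) - 1 / real (card U)"
    unfolding size sum_edge_flow_subtree[OF T y] using pos by (simp add: field_simps)
  finally show ?thesis .
qed

lemma sum_centered:
  assumes T: "rooted_tree r U p S" and v: "v \<in> U - {r}" and w: "w \<in> U - {r}"
  shows "(\<Sum>y\<in>U. centered U S v y) = 0"
    and "(\<Sum>y\<in>U. centered U S v y * centered U S w y) = cut_gram U S v w"
proof -
  have fin: "finite U" and r: "r \<in> U" using rooted_tree_basic[OF T] by auto
  have pos: "real (card U) > 0" using fin r by (auto simp: card_gt_0_iff)
  have sub: "U \<inter> S v = S v" "U \<inter> S w = S w" "U \<inter> (S v \<inter> S w) = S v \<inter> S w"
    using subtree_bounds(5)[OF T] v w by blast+
  have count: "(\<Sum>y\<in>U. of_bool (y \<in> A) :: real) = real (card (U \<inter> A))" for A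
    using fin by simp
  show "(\<Sum>y\<in>U. centered U S v y) = 0"
    using pos unfolding centered_def sum_subtractf count sub by simp
  have expand: "(a - s / u) * (b - t / u) = a * b - a * (t / u) - b * (s / u) + s * t / u\<^sup>2"
    for a b s t u :: real by (simp add: algebra_simps power2_eq_square)
  have "(\<Sum>y\<in>U. centered U S v y * centered U S w y)
    = (\<Sum>y\<in>U. of_bool (y \<in> S v \<inter> S w) - of_bool (y \<in> S v) * (real (card (S w)) / real (card U))
        - of_bool (y \<in> S w) * (real (card (S v)) / real (card U))
        + real (card (S v)) * real (card (S w)) / (real (card U))\<^sup>2)"
    unfolding centered_def Int_iff of_bool_conj expand ..
  also have "\<dots> = real (card (S v \<inter> S w)) - real (card (S v)) * (real (card (S w)) / real (card U))
      - real (card (S w)) * (real (card (S v)) / real (card U))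
      + real (card U) * (real (card (S v)) * real (card (S w)) / (real (card U))\<^sup>2)"
    unfolding sum.distrib sum_subtractf sum_distrib_right[symmetric] count sub by simp
  also have "\<dots> = cut_gram U S v w"
    using pos by (simp add: cut_gram_def field_simps power2_eq_square)
  finally show "(\<Sum>y\<in>U. centered U S v y * centered U S w y) = cut_gram U S v w" .
qed

text \<open>
  An edge contributes \<open>-1\<close> to an off-diagonal entry of the Laplacian exactly if it joins the
  two vertices of this entry.
\<close>
lemma of_bool_edge_eq:
  assumes "x \<noteq> y" "v \<noteq> u"
  shows "(of_bool ({x, y} = {v, u}) :: real)
    = - ((of_bool (x = v) - of_bool (x = u)) * (of_bool (y = v) - of_bool (y = u)))"
  using assms by (auto simp: doubleton_eq_iff)

lemma laplacian_edge_flow: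
  assumes T: "rooted_tree r {0..<n} p S" and E: "E = (\<lambda>v. {v, p v}) ` ({0..<n} - {r})"
    and x: "x < n" and y: "y < n"
  shows "laplacian n E $$ (x, y) = (\<Sum>v\<in>{0..<n} - {r}. edge_flow p x v * edge_flow p y v)"
proof -
  let ?V = "{0..<n} - {r}"
  have inj: "inj_on (\<lambda>v. {v, p v}) ?V" by (rule arcs_injective[OF T])
  have ne: "p v \<noteq> v" if "v \<in> ?V" for v using subtree_bounds(2)[OF T that] .
  show ?thesis
  proof (cases "x = y")
    case True
    have "{x, x} \<notin> E"
    proof
      assume "{x, x} \<in> E"
      then obtain v where "v \<in> ?V" "{x, x} = {v, p v}" unfolding E by blast
      then show False using ne[of v] by (auto simp: doubleton_eq_iff)
    qed
    moreover have "card {e \<in> E. x \<in> e} = card {v \<in> ?V. x = v \<or> x = p v}"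
    proof -
      have "{e \<in> E. x \<in> e} = (\<lambda>v. {v, p v}) ` {v \<in> ?V. x = v \<or> x = p v}"
        unfolding E by auto
      moreover have "inj_on (\<lambda>v. {v, p v}) {v \<in> ?V. x = v \<or> x = p v}"
        by (rule inj_on_subset[OF inj]) blast
      ultimately show ?thesis by (simp only: card_image)
    qed
    moreover have "real (card {v \<in> ?V. x = v \<or> x = p v}) = (\<Sum>v\<in>?V. of_bool (x = v \<or> x = p v))"
      by (subst sum_of_bool_eq) (simp_all only: finite_Diff finite_atLeastLessThan Int_def mem_Collect_eq)
    moreover have "\<dots> = (\<Sum>v\<in>?V. edge_flow p x v * edge_flow p y v)"
    proof (intro sum.cong refl)
      fix v assume "v \<in> ?V"
      then show "of_bool (x = v \<or> x = p v) = edge_flow p x v * edge_flow p y v"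
        using ne[of v] True by (cases "x = v"; cases "x = p v") (simp_all add: edge_flow_def)
    qed
    ultimately show ?thesis
      using True x by (simp add: laplacian_def degree_matrix_def adjacency_matrix_def)
  next
    case False
    have "of_bool ({x, y} \<in> E) = (\<Sum>v\<in>?V. of_bool ({x, y} = {v, p v}) :: real)"
    proof (cases "{x, y} \<in> E")
      case True
      then obtain w where w: "w \<in> ?V" "{x, y} = {w, p w}" unfolding E by blast
      have "(\<Sum>v\<in>?V. of_bool ({x, y} = {v, p v}) :: real) = (\<Sum>v\<in>?V. if v = w then 1 else 0)"
      proof (intro sum.cong refl)
        fix v assume v: "v \<in> ?V"
        show "of_bool ({x, y} = {v, p v}) = (if v = w then 1 else 0 :: real)"
          using inj_onD[OF inj _ v w(1)] w(2) by auto
      qed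
      then show ?thesis using True w(1) by simp
    next
      case False
      have "(\<Sum>v\<in>?V. of_bool ({x, y} = {v, p v}) :: real) = (\<Sum>v\<in>?V. 0)"
      proof (intro sum.cong refl)
        fix v assume "v \<in> ?V"
        then have "{x, y} \<noteq> {v, p v}" using False unfolding E by blast
        then show "of_bool ({x, y} = {v, p v}) = (0 :: real)" by (simp only: of_bool_eq)
      qed
      then show ?thesis using False by simp
    qed
    also have "\<dots> = (\<Sum>v\<in>?V. - (edge_flow p x v * edge_flow p y v))"
    proof (intro sum.cong refl)
      fix v assume "v \<in> ?V"
      then show "of_bool ({x, y} = {v, p v}) = - (edge_flow p x v * edge_flow p y v)"
        using ne[of v] False unfolding edge_flow_def by (simp add: of_bool_edge_eq)
    qed
    finally have "of_bool ({x, y} \<in> E) = - (\<Sum>v\<in>?V. edge_flow p x v * edge_flow p y v)"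
      by (simp add: sum_negf)
    then show ?thesis
      using False x y by (auto simp: laplacian_def degree_matrix_def adjacency_matrix_def of_bool_def split: if_splits)
  qed
qed

text \<open>
  The index \<open>0\<close> of the root stands for no edge, and this place is filled with the constant vector
  of norm \<open>1\<close>. So the incidence matrix and its left inverse become square matrices \<open>B\<close> and \<open>R\<close> that are
  inverse to each other. The Laplacian is \<open>B I B\<^sup>T\<close>, where \<open>I\<close> is the identity with entry \<open>0\<close> at the root, and is
  thus similar to \<open>I K\<close> with \<open>K = B\<^sup>T B\<close>. Clearing row \<open>0\<close> of \<open>K\<close> trades one eigenvalue \<open>1\<close> for
  the eigenvalue \<open>0\<close>; the remaining eigenvalues are the inverses of those of \<open>N = R R\<^sup>T\<close>.
\<close>
lemma tree_spectral_sum: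
  assumes T: "rooted_tree 0 {0..<n} p S" and E: "E = (\<lambda>v. {v, p v}) ` ({0..<n} - {0})"
  shows "(\<Sum>i = 2..n. 1 / (laplacian_eigenvalue n E i)\<^sup>2)
    = (\<Sum>v\<in>{0..<n} - {0}. \<Sum>w\<in>{0..<n} - {0}. (cut_gram {0..<n} S v w)\<^sup>2)"
proof -
  let ?U = "{0..<n}" and ?V = "{0..<n} - {0 :: nat}"
  have n: "n > 0" using rooted_tree_basic[OF T] by auto
  define q where "q = 1 / sqrt (real n)"
  have q: "q * q = 1 / real n" by (simp add: q_def)
  define B where "B = mat n n (\<lambda>(x, v). if v = 0 then q else edge_flow p x v)"
  define R where "R = mat n n (\<lambda>(v, y). if v = 0 then q else centered ?U S v y)"
  define I where "I = multrow 0 0 (1\<^sub>m n :: real mat)"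
  have B: "B \<in> carrier_mat n n" and R: "R \<in> carrier_mat n n" and I: "I \<in> carrier_mat n n"
    by (auto simp: B_def R_def I_def)
  have BT: "B\<^sup>T \<in> carrier_mat n n" and RT: "R\<^sup>T \<in> carrier_mat n n" using B R by auto
  have split0: "(\<Sum>v = 0..<n. f v) = f 0 + (\<Sum>v\<in>?V. f v)" for f :: "nat \<Rightarrow> real"
    using n by (subst sum.remove[of _ 0]) auto
  note assoc = assoc_mult_mat[of _ n n _ n _ n]
  have BR: "B * R = 1\<^sub>m n"
  proof (rule eq_matI)
    fix x y assume "x < dim_row (1\<^sub>m n :: real mat)" "y < dim_col (1\<^sub>m n :: real mat)"
    then have xy: "x < n" "y < n" by auto
    have "(B * R) $$ (x, y) = q * q + (\<Sum>v\<in>?V. edge_flow p x v * centered ?U S v y)"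
      using xy n by (simp add: B_def R_def scalar_prod_def split0)
    then show "(B * R) $$ (x, y) = 1\<^sub>m n $$ (x, y)"
      using sum_edge_flow_centered[OF T, of x y] xy q by simp
  qed (use B R in auto)
  have RB: "R * B = 1\<^sub>m n" by (rule mat_mult_left_right_inverse[OF B R BR])
  define K where "K = B\<^sup>T * B"
  define N where "N = R * R\<^sup>T"
  have K: "K \<in> carrier_mat n n" and N: "N \<in> carrier_mat n n" using B R by (auto simp: K_def N_def)
  have RBT: "B\<^sup>T * R\<^sup>T = 1\<^sub>m n"
    using RB transpose_mult[OF R B] by simp
  have KN: "K * N = 1\<^sub>m n"
  proof -
    have "K * N = B\<^sup>T * ((B * R) * R\<^sup>T)"
      unfolding K_def N_def using B R BT RT by (simp add: assoc)
    then show ?thesis using BR RBT RT by simp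
  qed
  have NK: "N * K = 1\<^sub>m n" by (rule mat_mult_left_right_inverse[OF K N KN])
  have N_entries: "N $$ (v, w) = (if v = 0 then of_bool (w = 0) else if w = 0 then 0 else cut_gram ?U S v w)"
    if "v < n" "w < n" for v w
  proof -
    have "N $$ (v, w) = (\<Sum>y\<in>?U. R $$ (v, y) * R $$ (w, y))"
      using that R by (simp add: N_def scalar_prod_def)
    also have "\<dots> = (\<Sum>y\<in>?U. (if v = 0 then q else centered ?U S v y) * (if w = 0 then q else centered ?U S w y))"
      using that by (intro sum.cong) (auto simp: R_def)
    finally have N_sum: "N $$ (v, w) = \<dots>" .
    have zero: "(\<Sum>y\<in>?U. centered ?U S u y) = 0" if "u < n" "u \<noteq> 0" for u
      by (rule sum_centered(1)[OF T]) (use that in auto)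
    show ?thesis
    proof (cases "v = 0"; cases "w = 0")
      assume "v = 0" "w = 0"
      moreover have "real n * (q * q) = 1" using n q by simp
      ultimately show ?thesis unfolding N_sum by (simp add: mult.left_commute)
    next
      assume "v = 0" "w \<noteq> 0"
      then show ?thesis unfolding N_sum using zero[of w] that by (simp flip: sum_distrib_left)
    next
      assume "v \<noteq> 0" "w = 0"
      then show ?thesis unfolding N_sum using zero[of v] that by (simp flip: sum_distrib_right)
    next
      assume "v \<noteq> 0" "w \<noteq> 0"
      moreover from this that have "(\<Sum>y\<in>?U. centered ?U S v y * centered ?U S w y) = cut_gram ?U S v w"
        by (intro sum_centered(2)[OF T]) auto
      ultimately show ?thesis unfolding N_sum by simp
    qed
  qed
  have K_row: "K $$ (0, j) = (if j = 0 then 1 else 0)" if j: "j < n" for j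
  proof -
    have "(1\<^sub>m n :: real mat) $$ (0, j) = (\<Sum>i = 0..<n. N $$ (0, i) * K $$ (i, j))"
      unfolding NK[symmetric] using j n K N by (simp add: scalar_prod_def)
    also have "\<dots> = (\<Sum>i = 0..<n. if i = 0 then K $$ (0, j) else 0)"
      using N_entries n by (intro sum.cong refl) auto
    finally show ?thesis using j n by simp
  qed
  have "laplacian n E = B * I * B\<^sup>T"
  proof (rule eq_matI)
    fix x y assume "x < dim_row (B * I * B\<^sup>T)" "y < dim_col (B * I * B\<^sup>T)"
    then have xy: "x < n" "y < n" using B by auto
    have BI: "(B * I) $$ (x, v) = (if v = 0 then 0 else B $$ (x, v))" if v: "v < n" for v
    proof -
      have "(B * I) $$ (x, v) = (\<Sum>i = 0..<n. B $$ (x, i) * I $$ (i, v))"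
        using xy v B I by (simp add: scalar_prod_def)
      also have "\<dots> = (\<Sum>i = 0..<n. if i = v then (if v = 0 then 0 else B $$ (x, v)) else 0)"
        using v by (intro sum.cong refl) (auto simp: I_def mat_multrow_def)
      finally show ?thesis using v by simp
    qed
    have "(X * B\<^sup>T) $$ (x, y) = (\<Sum>v = 0..<n. X $$ (x, v) * B $$ (y, v))"
      if "X \<in> carrier_mat n n" for X
      using xy B that by (simp add: scalar_prod_def)
    from this[of "B * I"]
    have "(B * I * B\<^sup>T) $$ (x, y) = (\<Sum>v = 0..<n. (B * I) $$ (x, v) * B $$ (y, v))"
      using B I by simp
    also have "\<dots> = (\<Sum>v\<in>?V. edge_flow p x v * edge_flow p y v)"
      unfolding split0 using BI xy n by (auto simp: B_def intro!: sum.cong)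
    finally show "laplacian n E $$ (x, y) = (B * I * B\<^sup>T) $$ (x, y)"
      using laplacian_edge_flow[OF T E xy] by simp
  qed (use B in \<open>auto simp: laplacian_def degree_matrix_def adjacency_matrix_def\<close>)
  also have "\<dots> = B * (I * K) * R"
  proof -
    have "B * (I * K) * R = B * (I * (B\<^sup>T * (B * R)))"
      unfolding K_def using B I R BT by (simp add: assoc)
    then show ?thesis using BR B I BT by (simp add: assoc)
  qed
  finally have lap: "laplacian n E = B * (I * K) * R" .
  have IK: "I * K = multrow 0 0 K"
  proof -
    have "I = multrow_mat n 0 0"
      unfolding I_def using multrow_mat[of "1\<^sub>m n :: real mat" n n 0 0] by simp
    then show ?thesis using multrow_mat[OF K, of 0 0] by simp
  qed
  have "char_poly (laplacian n E) = char_poly (multrow 0 0 K)"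
    unfolding IK[symmetric]
    by (rule char_poly_similar, rule similar_matI[of _ _ B R n])
       (use B R I K BR RB lap in auto)
  then have cp1: "[:- 1, 1:] * char_poly (laplacian n E) = [:0, 1:] * char_poly K"
    using char_poly_clear_row[OF K n, of 1] K_row by simp
  obtain ts where ts: "char_poly N = (\<Prod>e\<leftarrow>ts. [:- e, 1:])" "length ts = n" "\<And>e. e \<in> set ts \<Longrightarrow> e \<ge> 0"
    using char_poly_gram_splits[OF R] unfolding N_def by metis
  note inv = inverse_char_poly_and_square_sum[OF N K KN ts(1)]
  \<comment> \<open>The eigenvalue that belongs to the constant vector; it is removed from the list below.\<close>
  have one: "1 \<in> set ts"
  proof -
    have "poly ([:- 1, 1:] * char_poly (laplacian n E)) 1 = 0" by simp
    then have "poly (char_poly K) 1 = 0" unfolding cp1 by simp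
    then show ?thesis unfolding inv(1)
      by (auto simp: poly_prod_list prod_list_zero_iff)
  qed
  define es where "es = map (\<lambda>t. 1 / t) (remove1 1 ts)"
  have msts: "mset ts = add_mset 1 (mset (remove1 1 ts))" using one by simp
  have "char_poly K = (\<Prod>e\<in>#mset ts. [:- (1 / e), 1:])"
    unfolding inv(1) by (simp only: mset_map[symmetric] prod_mset_prod_list)
  also have "\<dots> = [:- 1, 1:] * (\<Prod>e\<leftarrow>es. [:- e, 1:])"
    unfolding msts es_def by (simp add: comp_def flip: prod_mset_prod_list)
  finally have "[:- 1, 1:] * char_poly (laplacian n E) = [:- 1, 1:] * ([:0, 1:] * (\<Prod>e\<leftarrow>es. [:- e, 1:]))"
    unfolding cp1 by (simp add: mult_ac del: mult_pCons_left mult_pCons_right)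
  then have "char_poly (laplacian n E) = [:0, 1:] * (\<Prod>e\<leftarrow>es. [:- e, 1:])"
    by (subst (asm) mult_cancel_left) simp
  moreover have "e \<ge> 0" if "e \<in> set es" for e
    using that ts(3) set_remove1_subset[of 1 ts] by (auto simp: es_def)
  ultimately have "(\<Sum>i = 2..n. 1 / (laplacian_eigenvalue n E i)\<^sup>2) = (\<Sum>e\<leftarrow>es. 1 / e\<^sup>2)"
    using one ts(2) n by (intro inverse_square_eigenvalue_sum) (auto simp: es_def length_remove1)
  also have "\<dots> = (\<Sum>t\<leftarrow>remove1 1 ts. t\<^sup>2)"
    by (simp add: es_def comp_def power_one_over)
  also have "\<dots> = (\<Sum>t\<leftarrow>ts. t\<^sup>2) - 1"
  proof -
    have "(\<Sum>t\<leftarrow>ts. t\<^sup>2) = (\<Sum>t\<in>#mset ts. t\<^sup>2)" by (simp only: mset_map[symmetric] sum_mset_sum_list)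
    also have "\<dots> = 1 + (\<Sum>t\<leftarrow>remove1 1 ts. t\<^sup>2)"
      unfolding msts by (simp flip: sum_mset_sum_list)
    finally show ?thesis by simp
  qed
  also have "(\<Sum>t\<leftarrow>ts. t\<^sup>2) = (\<Sum>v = 0..<n. \<Sum>w = 0..<n. N $$ (v, w) * N $$ (w, v))"
    unfolding inv(2) lessThan_atLeast0 ..
  also have "\<dots> = 1 + (\<Sum>v\<in>?V. \<Sum>w\<in>?V. N $$ (v, w) * N $$ (w, v))"
    unfolding split0 using n by (simp add: N_entries)
  also have "(\<Sum>v\<in>?V. \<Sum>w\<in>?V. N $$ (v, w) * N $$ (w, v)) = (\<Sum>v\<in>?V. \<Sum>w\<in>?V. (cut_gram ?U S v w)\<^sup>2)"
    by (intro sum.cong refl) (auto simp: N_entries cut_gram_def power2_eq_square Int_commute mult.commute)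
  finally show ?thesis by simp
qed

section \<open>Principal minors of the cut matrix\<close>

lemma cut_gram_diag:
  assumes T: "rooted_tree r U p S" and v: "v \<in> U - {r}"
  shows "cut_gram U S v v = real (card (S v)) * (real (card U) - real (card (S v))) / real (card U)"
    and "1 \<le> card (S v)" "card (S v) < card U"
proof -
  have fin: "finite U" and r: "r \<in> U" using rooted_tree_basic[OF T] by auto
  note b = subtree_bounds[OF T v]
  have "S v \<subset> U" using b(5) r by auto
  then show "card (S v) < card U" using fin by (rule psubset_card_mono[rotated])
  have "finite (S v)" using b(5) fin finite_subset by auto
  then show "1 \<le> card (S v)" using b(3) by (auto simp: Suc_le_eq card_gt_0_iff)
  show "cut_gram U S v v = real (card (S v)) * (real (card U) - real (card (S v))) / real (card U)"
  proof -
    have "real (card U) > 0" using fin r by (auto simp: card_gt_0_iff)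
    then show ?thesis by (simp add: cut_gram_def field_simps)
  qed
qed

text \<open>
  The numbers \<open>a\<close>, \<open>b\<close>, \<open>c\<close> are the sizes of the three components left after removing the edges \<open>v\<close>
  and \<open>w\<close>; the middle component, of size \<open>b\<close>, touches both edges, and \<open>a\<close> is the side of \<open>v\<close> away from \<open>w\<close>.
\<close>
lemma cut_gram_minor:
  assumes T: "rooted_tree r U p S" and v: "v \<in> U - {r}" and w: "w \<in> U - {r}" and ne: "v \<noteq> w"
  obtains a b c :: nat where "1 \<le> a" "1 \<le> b" "1 \<le> c" "a + b + c = card U"
    and "a = (if S w \<subset> S v then card U - card (S v) else card (S v))"
    and "cut_gram U S v v * cut_gram U S w w - (cut_gram U S v w)\<^sup>2 = real (a * b * c) / real (card U)"
proof -
  have fin: "finite U" and r: "r \<in> U" using rooted_tree_basic[OF T] by auto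
  have pos: "real (card U) > 0" using fin r by (auto simp: card_gt_0_iff)
  have finS: "finite (S v)" "finite (S w)"
    using subtree_bounds(5)[OF T v] subtree_bounds(5)[OF T w] fin
    by (meson finite_Diff finite_subset)+
  note sv = cut_gram_diag[OF T v] and sw = cut_gram_diag[OF T w]
  consider "S w \<subset> S v" | "S v \<subset> S w" | "S v \<inter> S w = {}" "\<not> S w \<subset> S v"
    using subtrees_laminar[OF T v w ne] by blast
  then show thesis
  proof cases
    case 1
    then have lt: "card (S w) < card (S v)" and int: "S v \<inter> S w = S w"
      using finS psubset_card_mono by auto
    show ?thesis
    proof (rule that[of "card U - card (S v)" "card (S v) - card (S w)" "card (S w)"])
      show "cut_gram U S v v * cut_gram U S w w - (cut_gram U S v w)\<^sup>2
          = real ((card U - card (S v)) * (card (S v) - card (S w)) * card (S w)) / real (card U)"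
        unfolding sv sw cut_gram_def[of U S v w] int
        using lt sv(3) pos by (simp add: of_nat_diff field_simps power2_eq_square)
    qed (use lt sv sw 1 in auto)
  next
    case 2
    then have lt: "card (S v) < card (S w)" and int: "S v \<inter> S w = S v"
      using finS psubset_card_mono by auto
    show ?thesis
    proof (rule that[of "card (S v)" "card (S w) - card (S v)" "card U - card (S w)"])
      show "cut_gram U S v v * cut_gram U S w w - (cut_gram U S v w)\<^sup>2
          = real (card (S v) * (card (S w) - card (S v)) * (card U - card (S w))) / real (card U)"
        unfolding sv sw cut_gram_def[of U S v w] int
        using lt sw(3) pos by (simp add: of_nat_diff field_simps power2_eq_square)
    qed (use lt sv sw 2 in auto)
  next
    case 3
    have "S v \<union> S w \<subset> U"
      using subtree_bounds(5)[OF T v] subtree_bounds(5)[OF T w] r by auto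
    then have lt: "card (S v) + card (S w) < card U"
      using psubset_card_mono[OF fin] card_Un_disjoint[OF finS 3(1)] by metis
    show ?thesis
    proof (rule that[of "card (S v)" "card U - card (S v) - card (S w)" "card (S w)"])
      show "cut_gram U S v v * cut_gram U S w w - (cut_gram U S v w)\<^sup>2
          = real (card (S v) * (card U - card (S v) - card (S w)) * card (S w)) / real (card U)"
        unfolding sv sw cut_gram_def[of U S v w] 3(1)
        using lt pos by (simp add: of_nat_diff field_simps power2_eq_square)
    qed (use lt sv sw 3 in auto)
  qed
qed

text \<open>
  For a given sum the product is smallest when two of the factors are \<open>1\<close>. The second claim
  excludes this case.
\<close>
lemma triple_product_ge:
  fixes a b c :: nat
  assumes "1 \<le> a" "1 \<le> b" "1 \<le> c"
  shows "a + b + c \<le> a * b * c + 2"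
    and "2 \<le> a \<Longrightarrow> 3 \<le> b + c \<Longrightarrow> a + b + c < a * b * c + 2"
proof -
  obtain x y z where xyz: "a = x + 1" "b = y + 1" "c = z + 1"
    using assms by (metis le_add_diff_inverse2)
  \<comment> \<open>With the factors written as \<open>x + 1\<close>, \<open>y + 1\<close>, \<open>z + 1\<close>, the excess is visibly nonnegative.\<close>
  have eq: "a * b * c + 2 = a + b + c + (x * y + y * z + x * z + x * y * z)"
    unfolding xyz by (simp add: algebra_simps)
  show "a + b + c \<le> a * b * c + 2" unfolding eq by simp
  assume "2 \<le> a" "3 \<le> b + c"
  then have "x * (y + z) > 0" unfolding xyz by auto
  then have "x * y + x * z > 0" by (simp add: distrib_left)
  then show "a + b + c < a * b * c + 2" unfolding eq by linarith
qed

lemma cut_gram_minor_ge: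
  assumes T: "rooted_tree r U p S" and v: "v \<in> U - {r}" and w: "w \<in> U - {r}" and ne: "v \<noteq> w"
  shows "(real (card U) - 2) / real (card U) \<le> cut_gram U S v v * cut_gram U S w w - (cut_gram U S v w)\<^sup>2"
proof -
  obtain a b c where abc: "1 \<le> a" "1 \<le> b" "1 \<le> c" "a + b + c = card U"
    and eq: "cut_gram U S v v * cut_gram U S w w - (cut_gram U S v w)\<^sup>2 = real (a * b * c) / real (card U)"
    using cut_gram_minor[OF assms] by metis
  have "card U \<le> a * b * c + 2" using triple_product_ge(1)[OF abc(1-3)] abc(4) by simp
  then have "real (card U) \<le> real (a * b * c) + 2" by linarith
  then show ?thesis unfolding eq by (intro divide_right_mono) auto
qed

text \<open>
  An edge with at least two vertices on both sides has at least three on one of them, as there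
  are five vertices in all. A second edge \<open>w\<close> on such a side leaves components with \<open>a \<ge> 2\<close> and
  \<open>b + c \<ge> 3\<close>.
\<close>
lemma cut_gram_minor_gt:
  assumes T: "rooted_tree r U p S" and U: "5 \<le> card U"
    and v: "v \<in> U - {r}" "card (S v) \<noteq> 1" "card (S v) \<noteq> card U - 1"
  obtains w where "w \<in> U - {r}" "v \<noteq> w"
    and "(real (card U) - 2) / real (card U) < cut_gram U S v v * cut_gram U S w w - (cut_gram U S v w)\<^sup>2"
proof -
  have fin: "finite U" and r: "r \<in> U" using rooted_tree_basic[OF T] by auto
  note sv = cut_gram_diag[OF T v(1)] and bv = subtree_bounds[OF T v(1)]
  have finS: "finite (S v)" using bv(5) fin finite_subset by auto
  have "\<exists>w\<in>U - {r}. v \<noteq> w \<and> 2 \<le> (if S w \<subset> S v then card U - card (S v) else card (S v))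
    \<and> (if S w \<subset> S v then card U - card (S v) else card (S v)) + 3 \<le> card U"
  proof (cases "card (S v) \<ge> 3")
    case True
    \<comment> \<open>The vertices below \<open>v\<close> are the edges on that side of \<open>v\<close>.\<close>
    have "S v - {v} \<noteq> {}"
    proof
      assume "S v - {v} = {}"
      then have "card (S v) \<le> card {v}" by (intro card_mono) auto
      then show False using True by simp
    qed
    then obtain w where w: "w \<in> S v" "w \<noteq> v" by auto
    then have wV: "w \<in> U - {r}" using bv(5) by auto
    have "p w \<in> S v" using subtree_mem_iff_parent[OF T v(1) wV] w by auto
    then have "\<not> S v \<subset> S w" "w \<in> S w" using subtree_bounds(3,4)[OF T wV] by auto
    then have "S w \<subset> S v" using subtrees_laminar[OF T v(1) wV] w by auto
    then show ?thesis using wV w sv v True by (intro bexI[of _ w]) auto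
  next
    case False
    then have 2: "card (S v) = 2" using v(2) sv(2) by linarith
    have "card (U - insert r (S v)) \<ge> card U - card (insert r (S v))"
      using finS by (intro diff_card_le_card_Diff) auto
    moreover have "card (insert r (S v)) \<le> 3" using card_insert_le_m1[of 3 "S v" r] 2 by simp
    ultimately have "card (U - insert r (S v)) > 0" using U by linarith
    then obtain w where w: "w \<in> U - {r}" "w \<notin> S v" by (auto simp: card_gt_0_iff)
    then have "\<not> S w \<subset> S v" "v \<noteq> w" using subtree_bounds(3)[OF T w(1)] bv(3) by auto
    then show ?thesis using w 2 U by (intro bexI[of _ w]) auto
  qed
  then obtain w where w: "w \<in> U - {r}" "v \<noteq> w"
    and large: "2 \<le> (if S w \<subset> S v then card U - card (S v) else card (S v))"
      "(if S w \<subset> S v then card U - card (S v) else card (S v)) + 3 \<le> card U" by blast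
  obtain a b c where abc: "1 \<le> a" "1 \<le> b" "1 \<le> c" "a + b + c = card U"
    and a: "a = (if S w \<subset> S v then card U - card (S v) else card (S v))"
    and eq: "cut_gram U S v v * cut_gram U S w w - (cut_gram U S v w)\<^sup>2 = real (a * b * c) / real (card U)"
    using cut_gram_minor[OF T v(1) w] by metis
  have "card U < a * b * c + 2"
    using triple_product_ge(2)[OF abc(1-3)] large abc(4) unfolding a[symmetric] by simp
  then have "real (card U) < real (a * b * c) + 2" by linarith
  then have "(real (card U) - 2) / real (card U) < real (a * b * c) / real (card U)"
    using U by (intro divide_strict_right_mono) auto
  then show thesis using that w eq by metis
qed

section \<open>The two bounds\<close>

text \<open>
  The diagonal entries alone suffice: \<open>s * (n - s) \<ge> n - 1\<close> whenever \<open>1 \<le> s \<le> n - 1\<close>.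
\<close>
lemma cut_gram_sum_ge:
  assumes T: "rooted_tree r U p S"
  shows "(real (card U) - 1) ^ 3 / (real (card U))\<^sup>2
    \<le> (\<Sum>v\<in>U - {r}. \<Sum>w\<in>U - {r}. (cut_gram U S v w)\<^sup>2)"
proof -
  let ?V = "U - {r}" and ?n = "real (card U)"
  have fin: "finite U" and r: "r \<in> U" using rooted_tree_basic[OF T] by auto
  have card: "real (card ?V) = ?n - 1" by (rule real_card_edges[OF T])
  have pos: "?n > 0" using fin r by (auto simp: card_gt_0_iff)
  have "((?n - 1) / ?n)\<^sup>2 \<le> (\<Sum>w\<in>?V. (cut_gram U S v w)\<^sup>2)" if v: "v \<in> ?V" for v
  proof -
    define s where "s = real (card (S v))"
    have "1 \<le> s" "s + 1 \<le> ?n"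
      using cut_gram_diag(2,3)[OF T v] by (auto simp: s_def)
    then have "0 \<le> (s - 1) * (?n - s - 1)" by simp
    then have le: "?n - 1 \<le> s * (?n - s)" by (simp add: algebra_simps)
    have "((?n - 1) / ?n)\<^sup>2 \<le> (cut_gram U S v v)\<^sup>2"
      unfolding cut_gram_diag(1)[OF T v] s_def[symmetric]
      using le pos \<open>s + 1 \<le> ?n\<close> \<open>1 \<le> s\<close> by (intro power_mono divide_right_mono) auto
    also have "\<dots> \<le> (\<Sum>w\<in>?V. (cut_gram U S v w)\<^sup>2)"
      using v fin by (intro member_le_sum) auto
    finally show ?thesis .
  qed
  then have "(\<Sum>v\<in>?V. ((?n - 1) / ?n)\<^sup>2) \<le> (\<Sum>v\<in>?V. \<Sum>w\<in>?V. (cut_gram U S v w)\<^sup>2)"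
    by (intro sum_mono)
  then show ?thesis using card by (simp add: power_divide power2_eq_square power3_eq_cube mult.assoc)
qed

text \<open>
  Expressing every squared entry through a principal minor leaves the squared trace minus the
  sum of all minors. If every edge ends in a leaf, the trace is \<open>(n - 1)\<^sup>2 / n\<close>, below its bound;
  otherwise some minor is above its bound. Either way the inequality is strict.
\<close>
lemma cut_gram_sum_less:
  fixes U :: "'a set"
  assumes T: "rooted_tree r U p S" and U: "5 \<le> card U"
  shows "(\<Sum>v\<in>U - {r}. \<Sum>w\<in>U - {r}. (cut_gram U S v w)\<^sup>2)
    < (((real (card U))\<^sup>2 - 1) / 6)\<^sup>2 - (real (card U) - 1) * (real (card U) - 2)\<^sup>2 / real (card U)"
proof -
  let ?V = "U - {r}" and ?n = "real (card U)"
  have fin: "finite U" and r: "r \<in> U" using rooted_tree_basic[OF T] by auto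
  have card: "real (card ?V) = ?n - 1" by (rule real_card_edges[OF T])
  have n5: "?n \<ge> 5" using U by simp
  define t where "t = (\<Sum>v\<in>?V. cut_gram U S v v)"
  \<comment> \<open>The minors \<open>m\<close> and their lower bounds \<open>l\<close>; the diagonal of \<open>m\<close> is zero.\<close>
  define m where "m = (\<lambda>v w. cut_gram U S v v * cut_gram U S w w - (cut_gram U S v w)\<^sup>2)"
  define l where "l = (\<lambda>v w :: 'a. if v = w then 0 else (?n - 2) / ?n)"
  have diag: "cut_gram U S v v \<ge> 0" if "v \<in> ?V" for v
    using cut_gram_diag[OF T that] by simp
  have t: "0 \<le> t" "t \<le> (?n\<^sup>2 - 1) / 6"
  proof -
    show "0 \<le> t" unfolding t_def by (intro sum_nonneg diag)
    have "t = (\<Sum>v\<in>?V. real (card (S v)) * (?n - real (card (S v)))) / ?n"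
      unfolding t_def sum_divide_distrib by (intro sum.cong refl) (simp add: cut_gram_diag[OF T])
    also have "\<dots> \<le> (?n * (?n\<^sup>2 - 1) / 6) / ?n"
      by (intro divide_right_mono sum_cut_sizes_le[OF T]) simp
    finally show "t \<le> (?n\<^sup>2 - 1) / 6" using n5 by simp
  qed
  have ml: "l v w \<le> m v w" if "v \<in> ?V" "w \<in> ?V" for v w
    using cut_gram_minor_ge[OF T that] by (auto simp: l_def m_def power2_eq_square)
  have row: "(\<Sum>w\<in>?V. l v w) = (?n - 2) * ((?n - 2) / ?n)" if "v \<in> ?V" for v
  proof -
    have "(\<Sum>w\<in>?V. l v w) = (\<Sum>w\<in>?V - {v}. (?n - 2) / ?n)"
    proof -
      have "(\<Sum>w\<in>?V. l v w) = l v v + (\<Sum>w\<in>?V - {v}. l v w)"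
        using that fin by (intro sum.remove) auto
      also have "(\<Sum>w\<in>?V - {v}. l v w) = (\<Sum>w\<in>?V - {v}. (?n - 2) / ?n)"
        by (intro sum.cong) (auto simp: l_def)
      finally show ?thesis by (simp add: l_def)
    qed
    also have "\<dots> = real (card (?V - {v})) * ((?n - 2) / ?n)" by simp
    also have "real (card (?V - {v})) = ?n - 2"
    proof -
      have "Suc (card (?V - {v})) = card ?V" using that fin by (intro card_Suc_Diff1) auto
      then show ?thesis using card by linarith
    qed
    finally show ?thesis .
  qed
  have suml: "(\<Sum>v\<in>?V. \<Sum>w\<in>?V. l v w) = (?n - 1) * (?n - 2)\<^sup>2 / ?n"
    using row card by (simp add: power2_eq_square)
  have "t\<^sup>2 = (\<Sum>v\<in>?V. \<Sum>w\<in>?V. cut_gram U S v v * cut_gram U S w w)"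
    by (simp add: t_def power2_eq_square sum_product)
  then have S2: "(\<Sum>v\<in>?V. \<Sum>w\<in>?V. (cut_gram U S v w)\<^sup>2) = t\<^sup>2 - (\<Sum>v\<in>?V. \<Sum>w\<in>?V. m v w)"
    by (simp add: m_def sum_subtractf)
  have t2: "t\<^sup>2 \<le> ((?n\<^sup>2 - 1) / 6)\<^sup>2" using t by (intro power_mono)
  have summ: "(\<Sum>v\<in>?V. \<Sum>w\<in>?V. l v w) \<le> (\<Sum>v\<in>?V. \<Sum>w\<in>?V. m v w)"
    by (intro sum_mono ml)
  show ?thesis
  proof (cases "\<forall>v\<in>?V. card (S v) = 1 \<or> card (S v) = card U - 1")
    case True
    have "t = (\<Sum>v\<in>?V. (?n - 1) / ?n)"
      unfolding t_def
    proof (intro sum.cong refl)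
      fix v assume v: "v \<in> ?V"
      from True v U have "real (card (S v)) = 1 \<or> real (card (S v)) = ?n - 1"
        by (auto simp: of_nat_diff)
      then show "cut_gram U S v v = (?n - 1) / ?n"
        unfolding cut_gram_diag(1)[OF T v] by auto
    qed
    then have "t = (?n - 1) * ((?n - 1) / ?n)" using card by simp
    also have "\<dots> < (?n\<^sup>2 - 1) / 6"
    proof -
      have "0 < (?n - 1) * ((?n - 2) * (?n - 3))" using n5 by simp
      then show ?thesis using n5 by (simp add: field_simps power2_eq_square)
    qed
    finally have "t\<^sup>2 < ((?n\<^sup>2 - 1) / 6)\<^sup>2" using t(1) by (intro power_strict_mono) auto
    then show ?thesis unfolding S2 using summ suml by linarith
  next
    case False
    then obtain v where v: "v \<in> ?V" "card (S v) \<noteq> 1" "card (S v) \<noteq> card U - 1" by blast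
    obtain w where w: "w \<in> ?V" "v \<noteq> w" "(?n - 2) / ?n < m v w"
      using cut_gram_minor_gt[OF T U v] unfolding m_def by blast
    have "(\<Sum>v\<in>?V. \<Sum>w\<in>?V. l v w) < (\<Sum>v\<in>?V. \<Sum>w\<in>?V. m v w)"
    proof (rule sum_strict_mono_ex1)
      have "(\<Sum>w\<in>?V. l v w) < (\<Sum>w\<in>?V. m v w)"
        using fin v(1) w ml by (intro sum_strict_mono_ex1) (auto simp: l_def intro!: bexI[of _ w])
      then show "\<exists>v\<in>?V. (\<Sum>w\<in>?V. l v w) < (\<Sum>w\<in>?V. m v w)" using v(1) by blast
    qed (use fin ml in \<open>auto intro!: sum_mono\<close>)
    then show ?thesis unfolding S2 using t2 suml by linarith
  qed
qed

text \<open>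
  The left-hand side grows like \<open>n / 4\<close> and the right-hand side like \<open>n\<close>; the line \<open>n - 3\<close> lies
  between them.
\<close>
lemma lower_bound_arith:
  fixes n :: real
  assumes "n \<ge> 5"
  shows "1 + (n - 2) ^ 3 / (2 * n - 3)\<^sup>2 < (n - 1) ^ 3 / n\<^sup>2"
proof -
  have "(n - 2) ^ 3 / (2 * n - 3)\<^sup>2 \<le> (n - 2) ^ 3 / (2 * (n - 2))\<^sup>2"
    using assms by (intro divide_left_mono power_mono) auto
  also have "\<dots> = (n - 2) / 4"
  proof -
    have "m ^ 3 / (2 * m)\<^sup>2 = m / 4" if "m > 0" for m :: real
      using that by (simp add: power2_eq_square power3_eq_cube)
    from this[of "n - 2"] show ?thesis using assms by linarith
  qed
  also have "\<dots> \<le> n - 4" using assms by simp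
  finally have "1 + (n - 2) ^ 3 / (2 * n - 3)\<^sup>2 \<le> n - 3" by simp
  also have "\<dots> < (n - 1) ^ 3 / n\<^sup>2"
    using assms by (simp add: field_simps power2_eq_square power3_eq_cube)
  finally show ?thesis .
qed

theorem theorem8:
  fixes n :: nat and E :: "nat set set" and \<beta> :: real
  assumes "n \<ge> 5" and "is_tree n E" and "\<beta> > 0"
  shows "1 / (2 * \<beta>) + (real n - 2) ^ 3 / (2 * \<beta> * (2 * real n - 3)\<^sup>2) < rho_ss_type2 \<beta> n E \<and>
    rho_ss_type2 \<beta> n E
      < ((real n)\<^sup>2 - 1)\<^sup>2 / (72 * \<beta>) - (real n - 1) * (real n - 2)\<^sup>2 / (2 * real n * \<beta>)"
proof -
  obtain p S where T: "rooted_tree 0 {0..<n} p S" and E: "E = (\<lambda>v. {v, p v}) ` ({0..<n} - {0})"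
    using assms(2) by (rule tree_rooting)
  define s where "s = (\<Sum>i = 2..n. 1 / (laplacian_eigenvalue n E i)\<^sup>2)"
  have "(real n - 1) ^ 3 / (real n)\<^sup>2 \<le> s"
    using cut_gram_sum_ge[OF T] by (simp add: s_def tree_spectral_sum[OF T E])
  with lower_bound_arith[of "real n"] assms(1)
  have lower: "1 + (real n - 2) ^ 3 / (2 * real n - 3)\<^sup>2 < s" by simp
  have upper: "s < (((real n)\<^sup>2 - 1) / 6)\<^sup>2 - (real n - 1) * (real n - 2)\<^sup>2 / real n"
    using cut_gram_sum_less[OF T] assms(1) by (simp add: s_def tree_spectral_sum[OF T E])
  have rho: "rho_ss_type2 \<beta> n E = s / (2 * \<beta>)"
    by (simp add: rho_ss_type2_def s_def)
  have lower_eq: "(1 + c / d) / (2 * \<beta>) = 1 / (2 * \<beta>) + c / (2 * \<beta> * d)" for c d :: real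
    by (simp add: add_divide_distrib mult_ac)
  have upper_eq: "((x / 6)\<^sup>2 - y / m) / (2 * \<beta>) = x\<^sup>2 / (72 * \<beta>) - y / (2 * m * \<beta>)" for x y m :: real
    by (simp add: diff_divide_distrib power_divide mult_ac)
  have "(1 + (real n - 2) ^ 3 / (2 * real n - 3)\<^sup>2) / (2 * \<beta>) < s / (2 * \<beta>)"
    using lower assms(3) by (intro divide_strict_right_mono) auto
  moreover have "s / (2 * \<beta>)
      < ((((real n)\<^sup>2 - 1) / 6)\<^sup>2 - (real n - 1) * (real n - 2)\<^sup>2 / real n) / (2 * \<beta>)"
    using upper assms(3) by (intro divide_strict_right_mono) auto
  ultimately show ?thesis
    unfolding rho lower_eq upper_eq by simp
qed

end
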